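(* Let $X_1,\dots,X_n$ be i.i.d. from a semiparametric model with true parameter $(\theta_0,\eta_0)$, where $\eta$ ranges over the Sobolev class $\mathcal H_m$. Let the smoothing parameter $\lambda_n$ satisfy $\lambda_n=o_P(n^{-1/4})$ and $\lambda_n^{-1}=O_P(n^{m/(2m+1)})$, let $\widehat S_{\lambda_n}(\theta)$ be the log-profile penalized likelihood and $\widehat\theta_{\lambda_n}$ its optimizer over $\Theta$ (the penalized MLE). Suppose that Condition G' (stated in the context) holds, that $\widehat\theta_{\lambda_n}$ is consistent, and that $\widetilde I_0$ is nonsingular. Then $$\sqrt n(\widehat\theta_{\lambda_n}-\theta_0)=\frac1{\sqrt n}\sum_{i=1}^n\widetilde I_0^{-1}\widetilde\ell_0(X_i)+O_P(\sqrt n\lambda_n^2).$$ Define $g=\max\{g':\lambda_n=O_P(n^{-g'})\}$, so that $1/4<g\le m/(2m+1)$. Let $\widehat\theta_{\lambda_n}^{(0)}$ be $n^\psi$-consistent (that is, $\|\widehat\theta_{\lambda_n}^{(0)}-\theta_0\|=O_P(n^{-\psi})$) for some $1/2-g<\psi\le1/2$, and for $k\ge1$ let $$\widehat\theta_{\lambda_n}^{(k)}=\widehat\theta_{\lambda_n}^{(k-1)}+\big[\widehat I_n(\widehat\theta_{\lambda_n}^{(k-1)})\big]^{-1}\widehat\ell_n(\widehat\theta_{\lambda_n}^{(k-1)}),\qquad\widehat\ell_n(\theta)=\widehat S_{\lambda_n}^{(1)}(\theta)/n,$$ where either (I) $\widehat I_n(\theta)=-\widehat S_{\lambda_n}^{(2)}(\theta)/n$,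 or (II) $[\widehat I_n(\theta)]_{ij}=-n^{-1/2}\dfrac{[\widehat S_{\lambda_n}^{(1)}(\theta+n^{-1/2}t_2v_j)]_i-[\widehat S_{\lambda_n}^{(1)}(\theta+n^{-1/2}t_1v_j)]_i}{t_2-t_1}$ for arbitrary fixed reals $t_1<t_2$. Write $\|\widehat\theta_{\lambda_n}^{(k)}-\widehat\theta_{\lambda_n}\|=O_P(n^{-r_k})$. Then $r_k$ increases from $\psi$ to $\infty$ as $k\to\infty$; specifically, $$\|\widehat\theta_{\lambda_n}^{(k)}-\widehat\theta_{\lambda_n}\|=O_P(n^{-2^k\psi})\text{ under (I)},\qquad\|\widehat\theta_{\lambda_n}^{(k)}-\widehat\theta_{\lambda_n}\|=O_P(n^{-R(\psi,g,k)})\text{ under (II)},$$ where $$R(\psi,g,k)=\begin{cases}R_1(\psi,g,k)& k\le L_1(\psi,g)\\ R_2\big(R_1(\psi,g,L_1(\psi,g)),g,k-L_1(\psi,g)\big)& k>L_1(\psi,g),\end{cases}$$ $R_1(\psi,g,k)=(1/2-g)+2^k(\psi+g-1/2)$, $R_2(\psi,g,k)=kg+\psi$, $L_1(\psi,g)=int\big[\log\{g/(g+\psi-1/2)\}/\log2\big]$. Consequently $\|\widehat\theta_{\lambda_n}^{(k^\ast)}-\widehat\theta_{\lambda_n}\|=o_P(n^{-1/2})$, where $k^\ast=\widetilde{int}\big[\log\{1/(2\psi)\}/\log2\big]$ under (I) and $k^\ast=\widetilde{int}\big[\log\{g/(g+\psi-1/2)\}/\log2\big]$ under (II).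
   Context: Notation. $int[x]$ and $\widetilde{int}[x]$ are the smallest nonnegative integers $\ge x$ and $>x$, respectively. $v_j$ is the $j$-th unit vector in $\mathbb R^d$; a superscript $(j)$ on a function denotes its $j$-th derivative; $a\vee b=\max(a,b)$; $\mathcal N(\theta_0)$ is a neighborhood of $\theta_0$ in $\mathbb R^d$; $\mathbb P_n$ is the empirical distribution. Setting. The model is indexed by $\theta\in\Theta\subset\mathbb R^d$ and $\eta\in\mathcal H_m=\{\eta:J^2(\eta)=\int_{\mathcal Z}(\eta^{(m)}(z))^2dz<\infty\}$, with $\mathcal Z$ a compact set on the real line, and has one-observation log-likelihood $\log lik(X;\theta,\eta)$. The penalized log-likelihood is $\log lik_{\lambda_n}(\theta,\eta)=n\mathbb P_n\log lik(\theta,\eta)-n\lambda_n^2J^2(\eta)$. For fixed $\theta$, $\widehat\eta_{\lambda_n}(\theta)=\arg\sup_{\eta\in\mathcal H_m}\log lik_{\lambda_n}(\theta,\eta)$, and $\widehat S_{\lambda_n}(\theta)=\log lik_{\lambda_n}(\theta,\widehat\eta_{\lambda_n}(\theta))$, whose maximizer over $\Theta$ is $\widehat\theta_{\lambda_n}$ (when the criterion is written as a penalized loss, $\widehat\theta_{\lambda_n}$ is its minimizer). The efficient score $\widetilde\ell_0$ is the residual of the $L_2$-projection of the score for $\theta$ at $(\theta_0,\eta_0)$ onto the closed linear span of the nuisance scores; $\widetilde I_0$ is its covariance matrix. Condition G'. For some constant $c$, $$\tfrac1n\widehat S_{\lambda_n}^{(1)}(\theta_0)-c\,\mathbb P_n\widetilde\ell_0=O_P(\lambda_n^2),$$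 $$\Big|\tfrac1n\widehat S_{\lambda_n}^{(2)}(\theta)+c\widetilde I_0\Big|=O_P(\lambda_n\vee\|\theta-\theta_0\|)\ \text{ uniformly over }\theta\in\mathcal N(\theta_0),\qquad\sup_{\theta\in\mathcal N(\theta_0)}\Big|\tfrac1n\widehat S_{\lambda_n}^{(3)}(\theta)\Big|=O_P(1).$$
   Formalization: The constant c in Condition G' is taken to be nonzero (with c = 0 the claim fails), and the asserted 1/4 < g is replaced by 1/4 ≤ g, since λ_n = n^{-1/4}/log n gives g = 1/4; all rates are proved in that boundary case too. *)

theory Defs
  imports "HOL-Probability.Probability"
begin

text \<open>Profile likelihoods and the estimators derived from them need not be measurable, so
  probabilities of the relevant events are outer probabilities.  For measurable events these are
  the ordinary probabilities.  The comparison rate \<open>r\<close> may itself be random.\<close>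

definition whp :: "'w measure \<Rightarrow> (nat \<Rightarrow> 'w \<Rightarrow> bool) \<Rightarrow> bool" where
  "whp M P \<longleftrightarrow> (\<lambda>n. outer_measure_of M {\<omega> \<in> space M. \<not> P n \<omega>}) \<longlonglongrightarrow> 0"

definition smallo_P :: "'w measure \<Rightarrow> (nat \<Rightarrow> 'w \<Rightarrow> 'a::real_normed_vector) \<Rightarrow> (nat \<Rightarrow> 'w \<Rightarrow> real) \<Rightarrow> bool" where
  "smallo_P M Y r \<longleftrightarrow> (\<forall>\<epsilon>>0. whp M (\<lambda>n \<omega>. norm (Y n \<omega>) \<le> \<epsilon> * r n \<omega>))"

definition bigo_P_uniformly ::
  "'w measure \<Rightarrow> 't set \<Rightarrow> (nat \<Rightarrow> 'w \<Rightarrow> 't \<Rightarrow> 'a::real_normed_vector) \<Rightarrow> (nat \<Rightarrow> 'w \<Rightarrow> 't \<Rightarrow> real) \<Rightarrow> bool" where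
  "bigo_P_uniformly M N Y r \<longleftrightarrow>
     (\<forall>\<epsilon>>0. \<exists>C. \<forall>\<^sub>F n in sequentially.
        outer_measure_of M {\<omega> \<in> space M. \<exists>\<theta>\<in>N. norm (Y n \<omega> \<theta>) > C * r n \<omega> \<theta>} \<le> ennreal \<epsilon>)"

definition bigo_P :: "'w measure \<Rightarrow> (nat \<Rightarrow> 'w \<Rightarrow> 'a::real_normed_vector) \<Rightarrow> (nat \<Rightarrow> 'w \<Rightarrow> real) \<Rightarrow> bool" where
  "bigo_P M Y r \<longleftrightarrow>
     (\<forall>\<epsilon>>0. \<exists>C. \<forall>\<^sub>F n in sequentially.
        outer_measure_of M {\<omega> \<in> space M. norm (Y n \<omega>) > C * r n \<omega>} \<le> ennreal \<epsilon>)"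

definition maximal_rate :: "'w measure \<Rightarrow> (nat \<Rightarrow> 'w \<Rightarrow> real) \<Rightarrow> real \<Rightarrow> bool" where
  "maximal_rate M lam g \<longleftrightarrow>
     bigo_P M lam (\<lambda>n \<omega>. real n powr (- g)) \<and>
     (\<forall>g'. bigo_P M lam (\<lambda>n \<omega>. real n powr (- g')) \<longrightarrow> g' \<le> g)"

text \<open>Derivatives are taken within \<open>Z\<close>, so that the values of \<open>f\<close> off \<open>Z\<close> play no role.  They are
  determined except at isolated points of \<open>Z\<close>, which form a null set.\<close>

definition deriv_within :: "real set \<Rightarrow> nat \<Rightarrow> (real \<Rightarrow> real) \<Rightarrow> real \<Rightarrow> real" where
  "deriv_within Z j = ((\<lambda>f z. vector_derivative f (at z within Z)) ^^ j)"

definition absolutely_cont_on :: "real set \<Rightarrow> (real \<Rightarrow> real) \<Rightarrow> bool" where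
  "absolutely_cont_on Z f \<longleftrightarrow>
     (\<forall>\<epsilon>>0. \<exists>\<delta>>0. \<forall>(n::nat) a b.
        (\<forall>i<n. a i \<in> Z \<and> b i \<in> Z \<and> a i \<le> b i) \<and>
        disjoint_family_on (\<lambda>i. {a i<..<b i}) {..<n} \<and> (\<Sum>i<n. b i - a i) < \<delta>
        \<longrightarrow> (\<Sum>i<n. \<bar>f (b i) - f (a i)\<bar>) < \<epsilon>)"

definition roughness :: "real set \<Rightarrow> nat \<Rightarrow> (real \<Rightarrow> real) \<Rightarrow> real" where
  "roughness Z m f = (LINT z:Z|lebesgue. (deriv_within Z m f z)\<^sup>2)"

text \<open>\<^term>\<open>roughness Z m f\<close> is \<open>J\<^sup>2(f)\<close>.  Its finiteness is the integrability condition below; the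
  other conditions say that the \<open>m\<close>-th derivative exists in the Sobolev sense, for \<open>m \<ge> 1\<close>.\<close>

definition sobolev_class :: "real set \<Rightarrow> nat \<Rightarrow> (real \<Rightarrow> real) set" where
  "sobolev_class Z m =
     {f. (\<forall>j. Suc j < m \<longrightarrow> (\<forall>z\<in>Z. deriv_within Z j f differentiable (at z within Z))) \<and>
         absolutely_cont_on Z (deriv_within Z (m - 1) f) \<and>
         set_integrable lebesgue Z (\<lambda>z. (deriv_within Z m f z)\<^sup>2)}"

type_synonym ('d, 'x) likelihood = "real ^ 'd \<Rightarrow> (real \<Rightarrow> real) \<Rightarrow> 'x \<Rightarrow> real"

definition model_dist ::
  "'x measure \<Rightarrow> ('d, 'x) likelihood \<Rightarrow> real ^ 'd \<Rightarrow> (real \<Rightarrow> real) \<Rightarrow> 'x measure" where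
  "model_dist \<mu> lik \<theta> \<eta> = density \<mu> (\<lambda>x. ennreal (lik \<theta> \<eta> x))"

definition semiparametric_model ::
  "'x measure \<Rightarrow> (real ^ 'd) set \<Rightarrow> (real \<Rightarrow> real) set \<Rightarrow> ('d, 'x) likelihood \<Rightarrow> bool" where
  "semiparametric_model \<mu> \<Theta> H lik \<longleftrightarrow>
     sigma_finite_measure \<mu> \<and>
     (\<forall>\<theta>\<in>\<Theta>. \<forall>\<eta>\<in>H. lik \<theta> \<eta> \<in> borel_measurable \<mu> \<and> (\<forall>x\<in>space \<mu>. 0 \<le> lik \<theta> \<eta> x) \<and>
        prob_space (model_dist \<mu> lik \<theta> \<eta>))"

definition sq_integrable :: "'x measure \<Rightarrow> ('x \<Rightarrow> real) \<Rightarrow> bool" where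
  "sq_integrable P f \<longleftrightarrow> f \<in> borel_measurable P \<and> integrable P (\<lambda>x. (f x)\<^sup>2)"

text \<open>In the two score definitions the likelihood is required to be positive near the true
  parameter, because \<^term>\<open>ln 0 = (0::real)\<close> would otherwise allow spurious derivatives.\<close>

definition is_theta_score ::
  "'x measure \<Rightarrow> ('d::finite, 'x) likelihood \<Rightarrow> real ^ 'd \<Rightarrow> (real \<Rightarrow> real) \<Rightarrow> ('x \<Rightarrow> real ^ 'd) \<Rightarrow> bool" where
  "is_theta_score \<mu> lik \<theta>\<^sub>0 \<eta>\<^sub>0 s \<longleftrightarrow>
     (\<forall>i. sq_integrable (model_dist \<mu> lik \<theta>\<^sub>0 \<eta>\<^sub>0) (\<lambda>x. s x $ i)) \<and>
     (AE x in model_dist \<mu> lik \<theta>\<^sub>0 \<eta>\<^sub>0.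
        (\<forall>\<^sub>F \<theta> in nhds \<theta>\<^sub>0. lik \<theta> \<eta>\<^sub>0 x > 0) \<and> GDERIV (\<lambda>\<theta>. ln (lik \<theta> \<eta>\<^sub>0 x)) \<theta>\<^sub>0 :> s x)"

definition nuisance_scores ::
  "'x measure \<Rightarrow> ('d, 'x) likelihood \<Rightarrow> (real \<Rightarrow> real) set \<Rightarrow> real ^ 'd \<Rightarrow> (real \<Rightarrow> real) \<Rightarrow> ('x \<Rightarrow> real) set" where
  "nuisance_scores \<mu> lik H \<theta>\<^sub>0 \<eta>\<^sub>0 =
     {s. sq_integrable (model_dist \<mu> lik \<theta>\<^sub>0 \<eta>\<^sub>0) s \<and>
         (\<exists>h\<in>H. AE x in model_dist \<mu> lik \<theta>\<^sub>0 \<eta>\<^sub>0.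
            (\<forall>\<^sub>F t in nhds 0. lik \<theta>\<^sub>0 (\<lambda>z. \<eta>\<^sub>0 z + t * h z) x > 0) \<and>
            ((\<lambda>t. ln (lik \<theta>\<^sub>0 (\<lambda>z. \<eta>\<^sub>0 z + t * h z) x)) has_real_derivative s x) (at 0))}"

definition L2_closed_span :: "'x measure \<Rightarrow> ('x \<Rightarrow> real) set \<Rightarrow> ('x \<Rightarrow> real) set" where
  "L2_closed_span P S =
     {k. sq_integrable P k \<and>
         (\<forall>\<epsilon>>0. \<exists>F c. finite F \<and> F \<subseteq> S \<and> (\<integral>x. (k x - (\<Sum>s\<in>F. c s * s x))\<^sup>2 \<partial>P) < \<epsilon>)}"

definition is_L2_projection :: "'x measure \<Rightarrow> ('x \<Rightarrow> real) set \<Rightarrow> ('x \<Rightarrow> real) \<Rightarrow> ('x \<Rightarrow> real) \<Rightarrow> bool" where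
  "is_L2_projection P V f k \<longleftrightarrow> k \<in> V \<and> (\<forall>v\<in>V. (\<integral>x. (f x - k x) * v x \<partial>P) = 0)"

definition is_efficient_score ::
  "'x measure \<Rightarrow> ('d::finite, 'x) likelihood \<Rightarrow> (real \<Rightarrow> real) set \<Rightarrow> real ^ 'd \<Rightarrow> (real \<Rightarrow> real)
     \<Rightarrow> ('x \<Rightarrow> real ^ 'd) \<Rightarrow> bool" where
  "is_efficient_score \<mu> lik H \<theta>\<^sub>0 \<eta>\<^sub>0 l \<longleftrightarrow>
     (let P = model_dist \<mu> lik \<theta>\<^sub>0 \<eta>\<^sub>0; V = L2_closed_span P (nuisance_scores \<mu> lik H \<theta>\<^sub>0 \<eta>\<^sub>0) in
      \<exists>s k. is_theta_score \<mu> lik \<theta>\<^sub>0 \<eta>\<^sub>0 s \<and>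
        (\<forall>i. is_L2_projection P V (\<lambda>x. s x $ i) (\<lambda>x. k x $ i)) \<and>
        (\<forall>x\<in>space P. l x = s x - k x))"

definition covariance_matrix :: "'x measure \<Rightarrow> ('x \<Rightarrow> real ^ 'd) \<Rightarrow> real ^ 'd ^ 'd" where
  "covariance_matrix P f =
     (\<chi> i j. \<integral>x. (f x $ i - (\<integral>y. f y $ i \<partial>P)) * (f x $ j - (\<integral>y. f y $ j \<partial>P)) \<partial>P)"

definition log_lik :: "('d, 'x) likelihood \<Rightarrow> real ^ 'd \<Rightarrow> (real \<Rightarrow> real) \<Rightarrow> 'x \<Rightarrow> ereal" where
  "log_lik lik \<theta> \<eta> x = (if lik \<theta> \<eta> x > 0 then ereal (ln (lik \<theta> \<eta> x)) else - \<infinity>)"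

definition pen_log_lik ::
  "real set \<Rightarrow> nat \<Rightarrow> ('d, 'x) likelihood \<Rightarrow> (nat \<Rightarrow> 'x) \<Rightarrow> nat \<Rightarrow> real \<Rightarrow> real ^ 'd \<Rightarrow> (real \<Rightarrow> real) \<Rightarrow> ereal" where
  "pen_log_lik Z m lik x n lam \<theta> \<eta> =
     (\<Sum>i<n. log_lik lik \<theta> \<eta> (x i)) - ereal (real n * lam\<^sup>2 * roughness Z m \<eta>)"

definition is_maximizer :: "('a \<Rightarrow> ereal) \<Rightarrow> 'a set \<Rightarrow> 'a \<Rightarrow> bool" where
  "is_maximizer f A a \<longleftrightarrow> a \<in> A \<and> (\<forall>b\<in>A. f b \<le> f a)"

definition partial :: "'d \<Rightarrow> (real ^ 'd::finite \<Rightarrow> real) \<Rightarrow> real ^ 'd \<Rightarrow> real" where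
  "partial i f \<theta> = frechet_derivative f (at \<theta>) (axis i 1)"

definition grad :: "(real ^ 'd::finite \<Rightarrow> real) \<Rightarrow> real ^ 'd \<Rightarrow> real ^ 'd" where
  "grad f \<theta> = (\<chi> i. partial i f \<theta>)"

definition hess :: "(real ^ 'd::finite \<Rightarrow> real) \<Rightarrow> real ^ 'd \<Rightarrow> real ^ 'd ^ 'd" where
  "hess f \<theta> = (\<chi> i j. partial j (partial i f) \<theta>)"

definition third_deriv :: "(real ^ 'd::finite \<Rightarrow> real) \<Rightarrow> real ^ 'd \<Rightarrow> real ^ 'd ^ 'd ^ 'd" where
  "third_deriv f \<theta> = (\<chi> i j k. partial k (partial j (partial i f)) \<theta>)"

definition three_times_differentiable_on :: "(real ^ 'd::finite \<Rightarrow> real) \<Rightarrow> (real ^ 'd) set \<Rightarrow> bool" where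
  "three_times_differentiable_on f N \<longleftrightarrow>
     (\<forall>\<theta>\<in>N. f differentiable (at \<theta>) \<and> grad f differentiable (at \<theta>) \<and> hess f differentiable (at \<theta>))"

text \<open>\<open>S n \<omega>\<close> is the log-profile penalized likelihood, with values in the extended reals since the
  likelihood may vanish.  That its derivatives exist on \<open>N\<close> is part of the condition.  The constant
  \<open>c\<close> must be nonzero: for \<open>c = 0\<close> the leading terms vanish and the condition carries no
  information about \<open>\<theta>\<^sub>0\<close>.\<close>

definition condition_G' ::
  "'w measure \<Rightarrow> (real ^ 'd::finite) set \<Rightarrow> (nat \<Rightarrow> 'w \<Rightarrow> 'x) \<Rightarrow> (nat \<Rightarrow> 'w \<Rightarrow> real)
     \<Rightarrow> (nat \<Rightarrow> 'w \<Rightarrow> real ^ 'd \<Rightarrow> ereal) \<Rightarrow> real ^ 'd \<Rightarrow> ('x \<Rightarrow> real ^ 'd) \<Rightarrow> real ^ 'd ^ 'd \<Rightarrow> bool" where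
  "condition_G' M \<Theta> X lam S \<theta>\<^sub>0 l I \<longleftrightarrow>
     (let Sr = (\<lambda>n \<omega> \<theta>. real_of_ereal (S n \<omega> \<theta>)) in
      \<exists>c N. c \<noteq> 0 \<and> open N \<and> \<theta>\<^sub>0 \<in> N \<and> N \<subseteq> \<Theta> \<and>
        whp M (\<lambda>n \<omega>. (\<forall>\<theta>\<in>N. \<bar>S n \<omega> \<theta>\<bar> \<noteq> \<infinity>) \<and> three_times_differentiable_on (Sr n \<omega>) N) \<and>
        bigo_P M (\<lambda>n \<omega>. (1 / real n) *\<^sub>R grad (Sr n \<omega>) \<theta>\<^sub>0
                      - c *\<^sub>R ((1 / real n) *\<^sub>R (\<Sum>i<n. l (X i \<omega>)))) (\<lambda>n \<omega>. (lam n \<omega>)\<^sup>2) \<and>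
        bigo_P_uniformly M N (\<lambda>n \<omega> \<theta>. (1 / real n) *\<^sub>R hess (Sr n \<omega>) \<theta> + c *\<^sub>R I)
          (\<lambda>n \<omega> \<theta>. max (lam n \<omega>) (norm (\<theta> - \<theta>\<^sub>0))) \<and>
        bigo_P_uniformly M N (\<lambda>n \<omega> \<theta>. (1 / real n) *\<^sub>R third_deriv (Sr n \<omega>) \<theta>) (\<lambda>n \<omega> \<theta>. 1))"

definition observed_info :: "nat \<Rightarrow> (real ^ 'd::finite \<Rightarrow> real) \<Rightarrow> real ^ 'd \<Rightarrow> real ^ 'd ^ 'd" where
  "observed_info n S \<theta> = - ((1 / real n) *\<^sub>R hess S \<theta>)"

definition discretized_info ::
  "real \<Rightarrow> real \<Rightarrow> nat \<Rightarrow> (real ^ 'd::finite \<Rightarrow> real) \<Rightarrow> real ^ 'd \<Rightarrow> real ^ 'd ^ 'd" where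
  "discretized_info t1 t2 n S \<theta> =
     (\<chi> i j. - (real n powr (-1/2)) *
        ((grad S (\<theta> + (real n powr (-1/2) * t2) *\<^sub>R axis j 1) $ i
          - grad S (\<theta> + (real n powr (-1/2) * t1) *\<^sub>R axis j 1) $ i) / (t2 - t1)))"

primrec newton_iterate ::
  "(real ^ 'd::finite \<Rightarrow> real ^ 'd ^ 'd) \<Rightarrow> (real ^ 'd \<Rightarrow> real ^ 'd) \<Rightarrow> real ^ 'd \<Rightarrow> nat \<Rightarrow> real ^ 'd" where
  "newton_iterate I l \<theta> 0 = \<theta>"
| "newton_iterate I l \<theta> (Suc k) =
     newton_iterate I l \<theta> k + matrix_inv (I (newton_iterate I l \<theta> k)) *v l (newton_iterate I l \<theta> k)"

definition iterate_I :: "nat \<Rightarrow> (real ^ 'd::finite \<Rightarrow> real) \<Rightarrow> real ^ 'd \<Rightarrow> nat \<Rightarrow> real ^ 'd" where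
  "iterate_I n S = newton_iterate (observed_info n S) (\<lambda>\<theta>. (1 / real n) *\<^sub>R grad S \<theta>)"

definition iterate_II ::
  "real \<Rightarrow> real \<Rightarrow> nat \<Rightarrow> (real ^ 'd::finite \<Rightarrow> real) \<Rightarrow> real ^ 'd \<Rightarrow> nat \<Rightarrow> real ^ 'd" where
  "iterate_II t1 t2 n S = newton_iterate (discretized_info t1 t2 n S) (\<lambda>\<theta>. (1 / real n) *\<^sub>R grad S \<theta>)"

definition int_ge :: "real \<Rightarrow> nat" where
  "int_ge x = (LEAST k. x \<le> real k)"

definition int_gt :: "real \<Rightarrow> nat" where
  "int_gt x = (LEAST k. x < real k)"

definition R1 :: "real \<Rightarrow> real \<Rightarrow> nat \<Rightarrow> real" where
  "R1 \<psi> g k = (1/2 - g) + 2 ^ k * (\<psi> + g - 1/2)"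

definition R2 :: "real \<Rightarrow> real \<Rightarrow> nat \<Rightarrow> real" where
  "R2 \<psi> g k = real k * g + \<psi>"

definition L1 :: "real \<Rightarrow> real \<Rightarrow> nat" where
  "L1 \<psi> g = int_ge (ln (g / (g + \<psi> - 1/2)) / ln 2)"

definition R :: "real \<Rightarrow> real \<Rightarrow> nat \<Rightarrow> real" where
  "R \<psi> g k = (if k \<le> L1 \<psi> g then R1 \<psi> g k else R2 (R1 \<psi> g (L1 \<psi> g)) g (k - L1 \<psi> g))"

definition errors_of_increasing_order ::
  "'w measure \<Rightarrow> (nat \<Rightarrow> 'w \<Rightarrow> nat \<Rightarrow> 'a::real_normed_vector) \<Rightarrow> real \<Rightarrow> (nat \<Rightarrow> real) \<Rightarrow> bool" where
  "errors_of_increasing_order M Y \<psi> r \<longleftrightarrow>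
     r 0 = \<psi> \<and> strict_mono r \<and> filterlim r at_top sequentially \<and>
     (\<forall>k. bigo_P M (\<lambda>n \<omega>. Y n \<omega> k) (\<lambda>n \<omega>. real n powr (- r k)))"

end

theory Submission
  imports Defs
begin

text \<open>Everything is reduced to finitely many inequalities for the normalized gradient and Hessian
  of the criterion that hold, for a large constant, outside an event of small outer probability.
  The bound on the third derivative gives a second-order Taylor estimate of the gradient.  Since the
  gradient vanishes at the consistent maximizer, the score must have mean zero, so its empirical mean
  is of order \<open>1 / sqrt n\<close>; the expansion at \<open>\<theta>\<^sub>0\<close> then yields the rate and the linearization of the
  maximizer.  If \<open>e\<close> is the error of an iterate and \<open>a\<close> the distance between the information matrix
  used and the negative Hessian, one Newton step leaves an error of order \<open>a |e| + |e|\<^sup>2\<close>,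
  where \<open>a = 0\<close> for (I) and \<open>a\<close> is of order \<open>1 / sqrt n\<close> for (II).  Hence the exponents may be taken with
  \<open>r (k + 1) \<le> 2 r k\<close> and, for (II), also \<open>r (k + 1) \<le> r k + 1/2\<close>, which \<open>R\<close> satisfies.\<close>

subsection \<open>Tightness in outer probability\<close>

text \<open>The delicate point is the order of choices. Condition G' supplies a constant C only up
  to an event of small outer probability, while absorbing the quadratic remainder requires the
  maximizer to lie within a radius that shrinks as C grows. So C is fixed first and the radius
  afterwards; consistency holds for every fixed radius and costs nothing in the limit.
  \<open>bigo_PI\<close> is built around this order. Mean zero of the score cannot be read off from
  its definition: a pointwise derivative of the log-likelihood integrates to zero only if derivative
  and integral may be exchanged, which is not assumed. The existence of a consistent root forces it
  instead. The constant c travels with \<open>I0\<close> as one invertible matrix, so its sign never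
  enters, and it cancels in the linearization. The exponents \<open>R\<close> are not the largest
  that the recursion permits: the quadratic Taylor bound makes the discretization error of order
  n^(-1/2), and since g <= 1/2 the resulting growth is at least that of \<open>R\<close>.\<close>

lemma outer_measure_of_Un_le:
  assumes "A \<subseteq> space M" "B \<subseteq> space M"
  shows "outer_measure_of M (A \<union> B) \<le> outer_measure_of M A + outer_measure_of M B"
proof -
  \<comment> \<open>Measurable hulls of equal outer measure stand in for the possibly nonmeasurable
    sets, so that subadditivity of the measure applies.\<close>
  obtain E F where E: "E \<in> sets M" "A \<subseteq> E" "outer_measure_of M A = emeasure M E"
    and F: "F \<in> sets M" "B \<subseteq> F" "outer_measure_of M B = emeasure M F"
    using outer_measure_of_attain assms by metis
  have "outer_measure_of M (A \<union> B) \<le> outer_measure_of M (E \<union> F)"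
    using E F by (intro outer_measure_of_mono) auto
  also have "\<dots> \<le> emeasure M E + emeasure M F"
    using E F by (simp add: emeasure_subadditive)
  finally show ?thesis using E F by simp
qed

text \<open>The bound is asked for all large C rather than for some C, since \<open>P\<close> need
  not be monotone in C. Several such conditions can then be met with one common constant. The
  threshold in n may depend on C and \<epsilon>.\<close>

definition tight_P :: "'w measure \<Rightarrow> (real \<Rightarrow> nat \<Rightarrow> 'w \<Rightarrow> bool) \<Rightarrow> bool" where
  "tight_P M P \<longleftrightarrow>
     (\<forall>\<epsilon>>0. \<exists>C\<^sub>0. \<forall>C\<ge>C\<^sub>0. \<forall>\<^sub>F n in sequentially.
        outer_measure_of M {\<omega> \<in> space M. \<not> P C n \<omega>} \<le> ennreal \<epsilon>)"

lemma whp_iff: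
  "whp M P \<longleftrightarrow> (\<forall>\<epsilon>>0. \<forall>\<^sub>F n in sequentially.
     outer_measure_of M {\<omega> \<in> space M. \<not> P n \<omega>} \<le> ennreal \<epsilon>)"
  unfolding whp_def
proof safe
  fix \<epsilon> :: real assume "(\<lambda>n. outer_measure_of M {\<omega> \<in> space M. \<not> P n \<omega>}) \<longlonglongrightarrow> 0" "\<epsilon> > 0"
  then show "\<forall>\<^sub>F n in sequentially. outer_measure_of M {\<omega> \<in> space M. \<not> P n \<omega>} \<le> ennreal \<epsilon>"
    using order_tendstoD(2)[of "\<lambda>n. outer_measure_of M {\<omega> \<in> space M. \<not> P n \<omega>}" 0 sequentially "ennreal \<epsilon>"]
    by (auto elim!: eventually_mono intro: less_imp_le)
next
  assume *: "\<forall>\<epsilon>>0. \<forall>\<^sub>F n in sequentially.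
     outer_measure_of M {\<omega> \<in> space M. \<not> P n \<omega>} \<le> ennreal \<epsilon>"
  show "(\<lambda>n. outer_measure_of M {\<omega> \<in> space M. \<not> P n \<omega>}) \<longlonglongrightarrow> 0"
  proof (rule order_tendstoI)
    fix a :: ennreal assume "0 < a"
    then obtain b where "0 < b" "b < a" using dense by blast
    then obtain \<epsilon> where "\<epsilon> > 0" "ennreal \<epsilon> < a"
      by (cases b) auto
    then show "\<forall>\<^sub>F n in sequentially. outer_measure_of M {\<omega> \<in> space M. \<not> P n \<omega>} < a"
      using * by (auto elim!: eventually_mono intro: le_less_trans)
  qed simp
qed

lemma whp_iff_tight_P: "whp M P \<longleftrightarrow> tight_P M (\<lambda>_. P)"
  unfolding tight_P_def whp_iff by (meson order_refl)

lemma tight_P_whpI: "(\<And>C. whp M (P C)) \<Longrightarrow> tight_P M P"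
  by (auto simp: tight_P_def whp_iff)

text \<open>Every large constant for \<open>Q\<close> is K times a large constant for
  \<open>P\<close>, which is how a fixed factor is absorbed. Nonlinear changes of the constant go
  through \<open>bigo_PI\<close>.\<close>

lemma tight_P_rescale:
  assumes "tight_P M P" "K > 0"
    and "\<And>C. C \<ge> C\<^sub>1 \<Longrightarrow> \<forall>\<^sub>F n in sequentially. \<forall>\<omega>\<in>space M. P C n \<omega> \<longrightarrow> Q (K * C) n \<omega>"
  shows "tight_P M Q"
  unfolding tight_P_def
proof (intro allI impI)
  fix \<epsilon> :: real assume "\<epsilon> > 0"
  with assms(1) obtain C\<^sub>0 where C\<^sub>0: "\<And>C. C \<ge> C\<^sub>0 \<Longrightarrow> \<forall>\<^sub>F n in sequentially.
      outer_measure_of M {\<omega> \<in> space M. \<not> P C n \<omega>} \<le> ennreal \<epsilon>"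
    unfolding tight_P_def by blast
  show "\<exists>C\<^sub>0. \<forall>C\<ge>C\<^sub>0. \<forall>\<^sub>F n in sequentially.
      outer_measure_of M {\<omega> \<in> space M. \<not> Q C n \<omega>} \<le> ennreal \<epsilon>"
  proof (intro exI[of _ "K * max C\<^sub>0 C\<^sub>1"] allI impI)
    fix C assume "K * max C\<^sub>0 C\<^sub>1 \<le> C"
    then have "max C\<^sub>0 C\<^sub>1 \<le> C / K"
      using \<open>K > 0\<close> by (subst pos_le_divide_eq) (simp_all add: mult.commute)
    then have "C\<^sub>0 \<le> C / K" "C\<^sub>1 \<le> C / K" by auto
    show "\<forall>\<^sub>F n in sequentially. outer_measure_of M {\<omega> \<in> space M. \<not> Q C n \<omega>} \<le> ennreal \<epsilon>"
      using C\<^sub>0[OF \<open>C\<^sub>0 \<le> C / K\<close>] assms(3)[OF \<open>C\<^sub>1 \<le> C / K\<close>]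
    proof eventually_elim
      case (elim n)
      have "{\<omega> \<in> space M. \<not> Q C n \<omega>} \<subseteq> {\<omega> \<in> space M. \<not> P (C / K) n \<omega>}"
        using elim(2) \<open>K > 0\<close> by auto
      then show ?case using elim(1) outer_measure_of_mono order_trans by blast
    qed
  qed
qed

lemma tight_P_mono:
  assumes "tight_P M P"
    and "\<And>C. C \<ge> C\<^sub>1 \<Longrightarrow> \<forall>\<^sub>F n in sequentially. \<forall>\<omega>\<in>space M. P C n \<omega> \<longrightarrow> Q C n \<omega>"
  shows "tight_P M Q"
  using tight_P_rescale[OF assms(1), of 1 C\<^sub>1 Q] assms(2) by simp

lemma tight_P_conj:
  assumes "tight_P M P" "tight_P M Q"
  shows "tight_P M (\<lambda>C n \<omega>. P C n \<omega> \<and> Q C n \<omega>)"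
  unfolding tight_P_def
proof (intro allI impI)
  fix \<epsilon> :: real assume "\<epsilon> > 0"
  then have "\<epsilon>/2 > 0" by simp
  then obtain C\<^sub>0 where C\<^sub>0: "\<And>C. C \<ge> C\<^sub>0 \<Longrightarrow> \<forall>\<^sub>F n in sequentially.
      outer_measure_of M {\<omega> \<in> space M. \<not> P C n \<omega>} \<le> ennreal (\<epsilon>/2)"
    using assms(1) unfolding tight_P_def by blast
  obtain C\<^sub>1 where C\<^sub>1: "\<And>C. C \<ge> C\<^sub>1 \<Longrightarrow> \<forall>\<^sub>F n in sequentially.
      outer_measure_of M {\<omega> \<in> space M. \<not> Q C n \<omega>} \<le> ennreal (\<epsilon>/2)"
    using assms(2) \<open>\<epsilon>/2 > 0\<close> unfolding tight_P_def by blast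
  show "\<exists>C\<^sub>0. \<forall>C\<ge>C\<^sub>0. \<forall>\<^sub>F n in sequentially.
      outer_measure_of M {\<omega> \<in> space M. \<not> (P C n \<omega> \<and> Q C n \<omega>)} \<le> ennreal \<epsilon>"
  proof (intro exI[of _ "max C\<^sub>0 C\<^sub>1"] allI impI)
    fix C assume "max C\<^sub>0 C\<^sub>1 \<le> C"
    then have "C\<^sub>0 \<le> C" "C\<^sub>1 \<le> C" by auto
    show "\<forall>\<^sub>F n in sequentially.
        outer_measure_of M {\<omega> \<in> space M. \<not> (P C n \<omega> \<and> Q C n \<omega>)} \<le> ennreal \<epsilon>"
      using C\<^sub>0[OF \<open>C\<^sub>0 \<le> C\<close>] C\<^sub>1[OF \<open>C\<^sub>1 \<le> C\<close>]
    proof eventually_elim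
      case (elim n)
      have "{\<omega> \<in> space M. \<not> (P C n \<omega> \<and> Q C n \<omega>)} =
          {\<omega> \<in> space M. \<not> P C n \<omega>} \<union> {\<omega> \<in> space M. \<not> Q C n \<omega>}" by auto
      then have "outer_measure_of M {\<omega> \<in> space M. \<not> (P C n \<omega> \<and> Q C n \<omega>)} \<le>
          outer_measure_of M {\<omega> \<in> space M. \<not> P C n \<omega>} + outer_measure_of M {\<omega> \<in> space M. \<not> Q C n \<omega>}"
        by (auto intro!: outer_measure_of_Un_le)
      also have "\<dots> \<le> ennreal (\<epsilon>/2) + ennreal (\<epsilon>/2)" using elim by (rule add_mono)
      also have "\<dots> = ennreal \<epsilon>" using \<open>\<epsilon> > 0\<close> by (simp flip: ennreal_plus)
      finally show ?case .
    qed
  qed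
qed

lemma whp_conj: "whp M P \<Longrightarrow> whp M Q \<Longrightarrow> whp M (\<lambda>n \<omega>. P n \<omega> \<and> Q n \<omega>)"
  using tight_P_conj[of M "\<lambda>_. P" "\<lambda>_. Q"] by (simp add: whp_iff_tight_P)

lemma whp_mono:
  assumes "whp M P" "\<forall>\<^sub>F n in sequentially. \<forall>\<omega>\<in>space M. P n \<omega> \<longrightarrow> Q n \<omega>"
  shows "whp M Q"
  using tight_P_mono[of M "\<lambda>_. P" 0 "\<lambda>_. Q"] assms by (simp add: whp_iff_tight_P)

text \<open>A claim about deterministic quantities can be refuted at a single sample point. Such a
  point exists once the exceptional set has outer probability at most 1/2, since the whole space has
  probability 1.\<close>

lemma (in prob_space) tight_P_ex:
  assumes "tight_P M P"
  obtains C where "C \<ge> C\<^sub>0" "\<forall>\<^sub>F n in sequentially. \<exists>\<omega>\<in>space M. P C n \<omega>"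
proof -
  obtain C\<^sub>1 where C\<^sub>1: "\<And>C. C \<ge> C\<^sub>1 \<Longrightarrow> \<forall>\<^sub>F n in sequentially.
      outer_measure_of M {\<omega> \<in> space M. \<not> P C n \<omega>} \<le> ennreal (1/2)"
    using assms unfolding tight_P_def by (elim allE[of _ "1/2"]) auto
  have "\<forall>\<^sub>F n in sequentially. \<exists>\<omega>\<in>space M. P (max C\<^sub>0 C\<^sub>1) n \<omega>"
    using C\<^sub>1[of "max C\<^sub>0 C\<^sub>1", OF max.cobounded2]
  proof eventually_elim
    case (elim n)
    show ?case
    proof (rule ccontr)
      assume "\<not> ?case"
      then have "{\<omega> \<in> space M. \<not> P (max C\<^sub>0 C\<^sub>1) n \<omega>} = space M" by auto
      then have "ennreal 1 \<le> ennreal (1/2)" using elim by (simp add: emeasure_space_1)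
      then show False by (subst (asm) ennreal_le_iff) auto
    qed
  qed
  then show ?thesis using that[of "max C\<^sub>0 C\<^sub>1"] by auto
qed

text \<open>A nonnegative rate makes the bound monotone in the constant, so that some constant is as
  good as all large ones. For a negative rate a larger constant would tighten the bound.\<close>

lemma bigo_P_uniformly_iff:
  assumes "\<forall>\<^sub>F n in sequentially. \<forall>\<omega>\<in>space M. \<forall>\<theta>\<in>N. r n \<omega> \<theta> \<ge> 0"
  shows "bigo_P_uniformly M N Y r \<longleftrightarrow>
    tight_P M (\<lambda>C n \<omega>. \<forall>\<theta>\<in>N. norm (Y n \<omega> \<theta>) \<le> C * r n \<omega> \<theta>)" (is "_ = tight_P M ?P")
proof
  assume *: "bigo_P_uniformly M N Y r"
  show "tight_P M ?P"
    unfolding tight_P_def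
  proof (intro allI impI)
    fix \<epsilon> :: real assume "\<epsilon> > 0"
    with * obtain C\<^sub>0 where C\<^sub>0: "\<forall>\<^sub>F n in sequentially.
        outer_measure_of M {\<omega> \<in> space M. \<exists>\<theta>\<in>N. norm (Y n \<omega> \<theta>) > C\<^sub>0 * r n \<omega> \<theta>} \<le> ennreal \<epsilon>"
      unfolding bigo_P_uniformly_def by blast
    have "\<forall>\<^sub>F n in sequentially. outer_measure_of M {\<omega> \<in> space M. \<not> ?P C n \<omega>} \<le> ennreal \<epsilon>"
      if "C \<ge> C\<^sub>0" for C
      using C\<^sub>0 assms
    proof eventually_elim
      case (elim n)
      have "{\<omega> \<in> space M. \<not> ?P C n \<omega>} \<subseteq> {\<omega> \<in> space M. \<exists>\<theta>\<in>N. norm (Y n \<omega> \<theta>) > C\<^sub>0 * r n \<omega> \<theta>}"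
        using elim(2) mult_right_mono[OF that] by (auto simp: not_le) (meson le_less_trans)
      then show ?case using elim(1) outer_measure_of_mono order_trans by blast
    qed
    then show "\<exists>C\<^sub>0. \<forall>C\<ge>C\<^sub>0. \<forall>\<^sub>F n in sequentially.
        outer_measure_of M {\<omega> \<in> space M. \<not> ?P C n \<omega>} \<le> ennreal \<epsilon>" by blast
  qed
next
  assume "tight_P M ?P"
  then show "bigo_P_uniformly M N Y r"
    unfolding tight_P_def bigo_P_uniformly_def by (simp add: not_le) (meson order_refl)
qed

lemma bigo_P_iff:
  assumes "\<forall>\<^sub>F n in sequentially. \<forall>\<omega>\<in>space M. r n \<omega> \<ge> 0"
  shows "bigo_P M Y r \<longleftrightarrow> tight_P M (\<lambda>C n \<omega>. norm (Y n \<omega>) \<le> C * r n \<omega>)"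
  using bigo_P_uniformly_iff[of M "{()}" "\<lambda>n \<omega> _. r n \<omega>" "\<lambda>n \<omega> _. Y n \<omega>"] assms
  by (simp add: bigo_P_uniformly_def bigo_P_def)

text \<open>The event \<open>Q\<close> and the constant \<open>D\<close> are chosen after C. Hence
  \<open>Q\<close> may demand closeness within a radius depending on C, and \<open>D\<close> may be
  any function of C. The two exceptional sets take \<epsilon>/2 each.\<close>

lemma bigo_PI:
  assumes "tight_P M P"
    and "\<And>C. C \<ge> C\<^sub>1 \<Longrightarrow> \<exists>Q D. whp M Q \<and>
      (\<forall>\<^sub>F n in sequentially. \<forall>\<omega>\<in>space M. P C n \<omega> \<longrightarrow> Q n \<omega> \<longrightarrow> norm (Y n \<omega>) \<le> D * r n \<omega>)"
  shows "bigo_P M Y r"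
  unfolding bigo_P_def
proof (intro allI impI)
  fix \<epsilon> :: real assume "\<epsilon> > 0"
  then obtain C\<^sub>0 where C\<^sub>0: "\<And>C. C \<ge> C\<^sub>0 \<Longrightarrow> \<forall>\<^sub>F n in sequentially.
      outer_measure_of M {\<omega> \<in> space M. \<not> P C n \<omega>} \<le> ennreal (\<epsilon>/2)"
    using assms(1) half_gt_zero[OF \<open>\<epsilon> > 0\<close>] unfolding tight_P_def by blast
  define C where "C = max C\<^sub>0 C\<^sub>1"
  have "C \<ge> C\<^sub>1" "C \<ge> C\<^sub>0" by (auto simp: C_def)
  obtain Q D where Q: "whp M Q" and
    D: "\<forall>\<^sub>F n in sequentially. \<forall>\<omega>\<in>space M. P C n \<omega> \<longrightarrow> Q n \<omega> \<longrightarrow> norm (Y n \<omega>) \<le> D * r n \<omega>"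
    using assms(2)[OF \<open>C \<ge> C\<^sub>1\<close>] by blast
  have "\<forall>\<^sub>F n in sequentially. outer_measure_of M {\<omega> \<in> space M. \<not> Q n \<omega>} \<le> ennreal (\<epsilon>/2)"
    using Q half_gt_zero[OF \<open>\<epsilon> > 0\<close>] unfolding whp_iff by blast
  then have "\<forall>\<^sub>F n in sequentially.
      outer_measure_of M {\<omega> \<in> space M. norm (Y n \<omega>) > D * r n \<omega>} \<le> ennreal \<epsilon>"
    using C\<^sub>0[OF \<open>C \<ge> C\<^sub>0\<close>] D
  proof eventually_elim
    case (elim n)
    have "outer_measure_of M {\<omega> \<in> space M. norm (Y n \<omega>) > D * r n \<omega>} \<le>
        outer_measure_of M ({\<omega> \<in> space M. \<not> P C n \<omega>} \<union> {\<omega> \<in> space M. \<not> Q n \<omega>})"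
      using elim(3) by (intro outer_measure_of_mono) (auto simp: not_le[symmetric])
    also have "\<dots> \<le> outer_measure_of M {\<omega> \<in> space M. \<not> P C n \<omega>} + outer_measure_of M {\<omega> \<in> space M. \<not> Q n \<omega>}"
      by (rule outer_measure_of_Un_le) auto
    also have "\<dots> \<le> ennreal (\<epsilon>/2) + ennreal (\<epsilon>/2)" using elim by (intro add_mono)
    also have "\<dots> = ennreal \<epsilon>" using \<open>\<epsilon> > 0\<close> by (simp flip: ennreal_plus)
    finally show ?case .
  qed
  then show "\<exists>C. \<forall>\<^sub>F n in sequentially.
      outer_measure_of M {\<omega> \<in> space M. norm (Y n \<omega>) > C * r n \<omega>} \<le> ennreal \<epsilon>" by blast
qed

subsection \<open>Matrices and second-order Taylor bounds\<close>

text \<open>The norm on matrices is the Frobenius norm, so Cauchy-Schwarz in each row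
  suffices.\<close>

lemma norm_matrix_vector_mult_le:
  fixes A :: "real ^ 'n ^ 'm"
  shows "norm (A *v x) \<le> norm A * norm x"
proof -
  have "norm (A *v x) = L2_set (\<lambda>i. norm ((A *v x) $ i)) UNIV"
    by (simp add: norm_vec_def)
  also have "\<dots> \<le> L2_set (\<lambda>i. norm (A $ i) * norm x) UNIV"
    by (intro L2_set_mono) (auto simp: matrix_vector_mul_component Cauchy_Schwarz_ineq2)
  also have "\<dots> = norm A * norm x"
    by (simp add: norm_vec_def[of A] L2_set_left_distrib)
  finally show ?thesis .
qed

lemma norm_matrix_le_sum:
  fixes A :: "real ^ 'n ^ 'm"
  shows "norm A \<le> (\<Sum>i\<in>UNIV. \<Sum>j\<in>UNIV. \<bar>A $ i $ j\<bar>)"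
proof -
  have "norm A \<le> (\<Sum>i\<in>UNIV. norm (A $ i))"
    unfolding norm_vec_def[of A] by (rule L2_set_le_sum) auto
  also have "\<dots> \<le> (\<Sum>i\<in>UNIV. \<Sum>j\<in>UNIV. \<bar>A $ i $ j\<bar>)"
    by (intro sum_mono norm_le_l1_cart)
  finally show ?thesis .
qed

lemma norm_matrix_le:
  fixes A :: "real ^ 'n ^ 'm"
  assumes "\<And>i j. \<bar>A $ i $ j\<bar> \<le> B"
  shows "norm A \<le> real CARD('m) * real CARD('n) * B"
proof -
  have "norm A \<le> (\<Sum>i\<in>UNIV. \<Sum>j\<in>UNIV. \<bar>A $ i $ j\<bar>)" by (rule norm_matrix_le_sum)
  also have "\<dots> \<le> (\<Sum>i\<in>(UNIV :: 'm set). \<Sum>j\<in>(UNIV :: 'n set). B)"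
    by (intro sum_mono assms)
  finally show ?thesis by simp
qed

lemma invertible_matrix_inv:
  fixes A :: "real ^ 'n ^ 'n"
  assumes "invertible A"
  shows "A ** matrix_inv A = mat 1" "matrix_inv A ** A = mat 1"
proof -
  from assms obtain B where "A ** B = mat 1 \<and> B ** A = mat 1"
    unfolding invertible_def by blast
  then have "A ** matrix_inv A = mat 1 \<and> matrix_inv A ** A = mat 1"
    unfolding matrix_inv_def by (rule someI)
  then show "A ** matrix_inv A = mat 1" "matrix_inv A ** A = mat 1" by auto
qed

lemma matrix_inv_vector_mult:
  fixes A :: "real ^ 'n ^ 'n"
  assumes "invertible A"
  shows "A *v (matrix_inv A *v x) = x" "matrix_inv A *v (A *v x) = x"
  by (simp_all add: matrix_vector_mul_assoc invertible_matrix_inv[OF assms])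

lemma invertible_lower_bound:
  fixes A :: "real ^ 'n ^ 'n"
  assumes "invertible A"
  obtains m where "m > 0" "\<And>x. norm x \<le> m * norm (A *v x)"
proof
  show "norm (matrix_inv A) + 1 > 0" by (simp add: add_nonneg_pos)
  fix x
  have "norm x = norm (matrix_inv A *v (A *v x))" by (simp add: matrix_inv_vector_mult assms)
  also have "\<dots> \<le> norm (matrix_inv A) * norm (A *v x)" by (rule norm_matrix_vector_mult_le)
  also have "\<dots> \<le> (norm (matrix_inv A) + 1) * norm (A *v x)" by (intro mult_right_mono) auto
  finally show "norm x \<le> (norm (matrix_inv A) + 1) * norm (A *v x)" .
qed

text \<open>If m is the constant of the lower bound for A, a perturbation of norm at most 1/(2m)
  costs at most half of that bound, so 2m serves for B. The bound makes B injective, hence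
  invertible because it is square, and it is at the same time the bound for the inverse.\<close>

lemma invertible_perturb:
  fixes A :: "real ^ 'n ^ 'n"
  assumes "invertible A"
  obtains \<rho> K where "\<rho> > 0" "K > 0"
    "\<And>B. norm (B - A) \<le> \<rho> \<Longrightarrow> invertible B"
    "\<And>B x. norm (B - A) \<le> \<rho> \<Longrightarrow> norm (matrix_inv B *v x) \<le> K * norm x"
proof -
  obtain m where m: "m > 0" "\<And>x. norm x \<le> m * norm (A *v x)"
    using invertible_lower_bound[OF assms] by blast
  have lower: "norm x \<le> 2 * m * norm (B *v x)" if "norm (B - A) \<le> 1 / (2 * m)" for B x
  proof -
    have "norm (A *v x) \<le> norm (B *v x) + norm ((B - A) *v x)"
      using norm_triangle_ineq4[of "B *v x" "(B - A) *v x"]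
      by (simp add: matrix_vector_mult_diff_rdistrib)
    also have "norm ((B - A) *v x) \<le> 1 / (2 * m) * norm x"
      by (rule order_trans[OF norm_matrix_vector_mult_le mult_right_mono]) (use that in auto)
    finally have "m * norm (A *v x) \<le> m * (norm (B *v x) + 1 / (2 * m) * norm x)"
      using m by simp
    also have "\<dots> = m * norm (B *v x) + norm x / 2" using m(1) by (simp add: field_simps)
    finally show ?thesis using m(2)[of x] by simp
  qed
  have inv: "invertible B" if "norm (B - A) \<le> 1 / (2 * m)" for B
  proof -
    have "inj ((*v) B)"
    proof (rule injI)
      fix x y assume "B *v x = B *v y"
      then have "norm (x - y) \<le> 0"
        using lower[OF that, of "x - y"] by (simp add: matrix_vector_mult_diff_distrib)
      then show "x = y" by simp
    qed
    then show ?thesis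
      by (simp add: invertible_left_inverse matrix_left_invertible_injective)
  qed
  show ?thesis
  proof
    fix B x assume *: "norm (B - A) \<le> 1 / (2 * m)"
    show "norm (matrix_inv B *v x) \<le> 2 * m * norm x"
      using lower[OF *, of "matrix_inv B *v x"] by (simp add: matrix_inv_vector_mult inv[OF *])
  qed (use m inv in auto)
qed

section \<open>Taylor estimate for the gradient\<close>

lemma has_derivative_grad:
  fixes f :: "real ^ 'd::finite \<Rightarrow> real"
  assumes "grad f differentiable (at \<theta>)"
  shows "(grad f has_derivative (\<lambda>v. hess f \<theta> *v v)) (at \<theta>)"
proof -
  define D where "D = frechet_derivative (grad f) (at \<theta>)"
  have D: "(grad f has_derivative D) (at \<theta>)"
    using assms by (simp add: D_def frechet_derivative_works)
  then have lin: "linear D" by (rule has_derivative_linear)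
  have "partial j (partial i f) \<theta> = D (axis j 1) $ i" for i j
  proof -
    have "((\<lambda>x. grad f x $ i) has_derivative (\<lambda>v. D v $ i)) (at \<theta>)"
      by (rule bounded_linear.has_derivative[OF bounded_linear_vec_nth D])
    then have "(partial i f has_derivative (\<lambda>v. D v $ i)) (at \<theta>)" by (simp add: grad_def)
    then show ?thesis by (simp add: partial_def flip: frechet_derivative_at)
  qed
  then have "hess f \<theta> = matrix D" by (simp add: hess_def matrix_def)
  then have "hess f \<theta> *v v = D v" for v by (simp add: matrix_works lin)
  then show ?thesis using D by simp
qed

lemma has_derivative_hess:
  fixes f :: "real ^ 'd::finite \<Rightarrow> real"
  assumes "hess f differentiable (at \<theta>)"
    and third: "\<And>i j k. \<bar>third_deriv f \<theta> $ i $ j $ k\<bar> \<le> B"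
  obtains D where "(hess f has_derivative D) (at \<theta>)"
    "\<And>v. norm (D v) \<le> real CARD('d) ^ 3 * B * norm v"
proof
  define D where "D = frechet_derivative (hess f) (at \<theta>)"
  show D: "(hess f has_derivative D) (at \<theta>)"
    using assms(1) by (simp add: D_def frechet_derivative_works)
  then have lin: "linear D" by (rule has_derivative_linear)
  have D_axis: "D (axis k 1) $ i $ j = third_deriv f \<theta> $ i $ j $ k" for i j k
  proof -
    have "((\<lambda>x. hess f x $ i $ j) has_derivative (\<lambda>v. D v $ i $ j)) (at \<theta>)"
      by (intro bounded_linear.has_derivative[OF bounded_linear_vec_nth]) (rule D)
    then have "(partial j (partial i f) has_derivative (\<lambda>v. D v $ i $ j)) (at \<theta>)"
      by (simp add: hess_def)
    then show ?thesis by (simp add: third_deriv_def partial_def[of k] flip: frechet_derivative_at)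
  qed
  fix v
  have "D v = (\<Sum>k\<in>UNIV. v $ k *\<^sub>R D (axis k 1))"
    by (subst basis_expansion[of v, symmetric])
      (simp add: linear_sum[OF lin] linear_cmul[OF lin] scalar_mult_eq_scaleR)
  also have "norm \<dots> \<le> (\<Sum>k\<in>UNIV. norm (v $ k *\<^sub>R D (axis k 1)))" by (rule norm_sum)
  \<comment> \<open>One factor d of the cube comes from expanding v along the axes, the other two
    from the entries of the matrix \<open>D (axis k 1)\<close>.\<close>
  also have "\<dots> \<le> (\<Sum>k\<in>(UNIV :: 'd set). norm v * (real CARD('d) * real CARD('d) * B))"
    by (intro sum_mono) (auto simp: D_axis intro!: mult_mono norm_matrix_le third component_le_norm_cart)
  also have "\<dots> = real CARD('d) ^ 3 * B * norm v" by (simp add: power3_eq_cube)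
  finally show "norm (D v) \<le> real CARD('d) ^ 3 * B * norm v" .
qed

text \<open>The third derivative is bounded but not assumed continuous, so there is no integral
  remainder to use. The mean value inequality serves twice: it makes the Hessian Lipschitz on the
  convex set, and then bounds the linearization error of the gradient along the segment. The usual
  factor 1/2 is given up.\<close>

lemma grad_taylor:
  fixes f :: "real ^ 'd::finite \<Rightarrow> real"
  assumes diff: "three_times_differentiable_on f S" and "convex S"
    and third: "\<And>\<theta>. \<theta> \<in> S \<Longrightarrow> norm (third_deriv f \<theta>) \<le> B"
    and x: "x \<in> S" and y: "y \<in> S"
  shows "norm (grad f y - grad f x - hess f x *v (y - x)) \<le> real CARD('d) ^ 3 * B * (norm (y - x))\<^sup>2"
proof -
  let ?L = "real CARD('d) ^ 3 * B"
  have B: "B \<ge> 0" using third[OF x] norm_ge_zero order_trans by blast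
  have "\<exists>D. (hess f has_derivative D) (at \<theta>) \<and> onorm D \<le> ?L" if "\<theta> \<in> S" for \<theta>
  proof -
    have "\<bar>third_deriv f \<theta> $ i $ j $ k\<bar> \<le> B" for i j k
      using component_le_norm_cart[of "third_deriv f \<theta> $ i $ j" k]
        Finite_Cartesian_Product.norm_nth_le[of "third_deriv f \<theta> $ i" j]
        Finite_Cartesian_Product.norm_nth_le[of "third_deriv f \<theta>" i] third[OF that] by linarith
    moreover have "hess f differentiable (at \<theta>)"
      using diff that by (simp add: three_times_differentiable_on_def)
    ultimately obtain D where "(hess f has_derivative D) (at \<theta>)" "\<And>v. norm (D v) \<le> ?L * norm v"
      using has_derivative_hess[of f \<theta> B] by metis
    then show ?thesis using B by (intro exI[of _ D]) (auto intro: onorm_bound)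
  qed
  then obtain D where D: "\<And>\<theta>. \<theta> \<in> S \<Longrightarrow> (hess f has_derivative D \<theta>) (at \<theta>)"
    "\<And>\<theta>. \<theta> \<in> S \<Longrightarrow> onorm (D \<theta>) \<le> ?L" by metis
  have lip: "norm (hess f z - hess f x) \<le> ?L * norm (z - x)" if "z \<in> S" for z
    using D that x by (intro differentiable_bound[OF \<open>convex S\<close>, of _ D]) (auto intro: has_derivative_at_withinI)
  have seg: "closed_segment x y \<subseteq> S" using assms by (simp add: closed_segment_subset)
  have "norm (grad f y - grad f x - hess f x *v (y - x)) \<le> norm (y - x) * (?L * norm (y - x))"
  proof (rule differentiable_bound_linearization[where S = "closed_segment x y" and f' = "\<lambda>\<theta> v. hess f \<theta> *v v"])
    fix t :: real assume "t \<in> {0..1}"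
    then show "x + t *\<^sub>R (y - x) \<in> closed_segment x y"
      by (auto simp: closed_segment_def algebra_simps intro!: exI[of _ t])
  next
    fix z assume z: "z \<in> closed_segment x y"
    then have "z \<in> S" using seg by blast
    then show "(grad f has_derivative (*v) (hess f z)) (at z within closed_segment x y)"
      using diff has_derivative_grad unfolding three_times_differentiable_on_def
      by (blast intro: has_derivative_at_withinI)
    have "norm (z - x) \<le> norm (y - x)"
      using segment_bound[OF z] by auto
    then have "norm (hess f z - hess f x) \<le> ?L * norm (y - x)"
      using lip[OF \<open>z \<in> S\<close>] B by (meson mult_left_mono order_trans mult_nonneg_nonneg of_nat_0_le_iff zero_le_power)
    show "onorm ((*v) (hess f z) - (*v) (hess f x)) \<le> ?L * norm (y - x)"
    proof (rule onorm_bound)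
      show "0 \<le> ?L * norm (y - x)" using B by simp
      fix v
      have "norm (((*v) (hess f z) - (*v) (hess f x)) v) = norm ((hess f z - hess f x) *v v)"
        by (simp add: matrix_vector_mult_diff_rdistrib)
      also have "\<dots> \<le> norm (hess f z - hess f x) * norm v" by (rule norm_matrix_vector_mult_le)
      also have "\<dots> \<le> ?L * norm (y - x) * norm v"
        by (rule mult_right_mono) (fact, simp)
      finally show "norm (((*v) (hess f z) - (*v) (hess f x)) v) \<le> ?L * norm (y - x) * norm v" .
    qed
  qed auto
  then show ?thesis by (simp add: power2_eq_square mult_ac)
qed

lemma grad_eq_0_at_max:
  fixes f :: "real ^ 'd::finite \<Rightarrow> real"
  assumes "f differentiable (at x)" "open S" "x \<in> S" "\<And>y. y \<in> S \<Longrightarrow> f y \<le> f x"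
  shows "grad f x = 0"
proof -
  have "frechet_derivative f (at x) = (\<lambda>v. 0)"
    using assms by (intro differential_zero_maxmin[of x S f]) (auto simp: frechet_derivative_works)
  then show ?thesis by (simp add: grad_def partial_def vec_eq_iff)
qed

subsection \<open>Root-n bound for empirical means\<close>

lemma powr_half_neg_power2: "x > 0 \<Longrightarrow> (x powr (-1/2))\<^sup>2 = 1 / x" for x :: real
  using powr_add[of x "-1/2" "-1/2"] by (simp add: power2_eq_square powr_minus_divide)

lemma (in prob_space) indep_vars_pair:
  assumes "indep_vars (\<lambda>_. N) Y I" "i \<in> I" "j \<in> I" "i \<noteq> j"
  shows "indep_var N (Y i) N (Y j)"
proof -
  have "indep_var (PiM {i} (\<lambda>_. N)) (\<lambda>\<omega>. restrict (\<lambda>i. Y i \<omega>) {i})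
      (PiM {j} (\<lambda>_. N)) (\<lambda>\<omega>. restrict (\<lambda>i. Y i \<omega>) {j})"
    using assms by (intro indep_var_restrict[OF assms(1)]) auto
  then have "indep_var N ((\<lambda>f. f i) \<circ> (\<lambda>\<omega>. restrict (\<lambda>i. Y i \<omega>) {i}))
      N ((\<lambda>f. f j) \<circ> (\<lambda>\<omega>. restrict (\<lambda>i. Y i \<omega>) {j}))"
    by (rule indep_var_compose) auto
  then show ?thesis by (simp add: comp_def)
qed

lemma (in prob_space) square_centered_sum:
  fixes Y :: "nat \<Rightarrow> 'a \<Rightarrow> real"
  assumes indep: "indep_vars (\<lambda>_. borel) Y UNIV"
    and int: "\<And>i. integrable M (Y i)" "\<And>i. integrable M (\<lambda>\<omega>. (Y i \<omega>)\<^sup>2)"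
    and centered: "\<And>i. expectation (Y i) = 0" and var: "\<And>i. expectation (\<lambda>\<omega>. (Y i \<omega>)\<^sup>2) = v"
  shows "integrable M (\<lambda>\<omega>. (\<Sum>i<n. Y i \<omega>)\<^sup>2)"
    and "expectation (\<lambda>\<omega>. (\<Sum>i<n. Y i \<omega>)\<^sup>2) = real n * v"
proof -
  have *: "integrable M (\<lambda>\<omega>. Y i \<omega> * Y j \<omega>) \<and>
      expectation (\<lambda>\<omega>. Y i \<omega> * Y j \<omega>) = (if i = j then v else 0)" for i j
  proof (cases "i = j")
    case False
    have "indep_var borel (Y i) borel (Y j)"
      using indep_vars_pair[OF indep _ _ False] by simp
    then show ?thesis
      using indep_var_integrable[of "Y i" "Y j"] indep_var_lebesgue_integral[of "Y i" "Y j"]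
        int(1) centered False by simp
  qed (use int var in \<open>simp flip: power2_eq_square\<close>)
  have eq: "(\<Sum>i<n. Y i \<omega>)\<^sup>2 = (\<Sum>i<n. \<Sum>j<n. Y i \<omega> * Y j \<omega>)" for \<omega>
    by (simp add: power2_eq_square sum_product)
  show "integrable M (\<lambda>\<omega>. (\<Sum>i<n. Y i \<omega>)\<^sup>2)" using * by (simp add: eq)
  show "expectation (\<lambda>\<omega>. (\<Sum>i<n. Y i \<omega>)\<^sup>2) = real n * v"
    using * by (simp add: eq)
qed

text \<open>Chebyshev's inequality, coordinates taken together: the squared norm of the centered sum
  has expectation n times a fixed V, so Markov's inequality at level C^2 n gives V / C^2 for every
  n. The mean is kept general, because mean zero of the score is only derived later.\<close>

lemma (in prob_space) iid_mean_tight: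
  fixes X :: "nat \<Rightarrow> 'a \<Rightarrow> 'x" and l :: "'x \<Rightarrow> real ^ 'd::finite"
  assumes indep: "indep_vars (\<lambda>_. \<mu>) X UNIV" and distr: "\<And>i. distr M \<mu> (X i) = P"
    and sq: "\<And>k. sq_integrable P (\<lambda>x. l x $ k)"
  shows "tight_P M (\<lambda>C n \<omega>. norm ((1 / real n) *\<^sub>R (\<Sum>i<n. l (X i \<omega>)) - (\<chi> k. \<integral>x. l x $ k \<partial>P))
    \<le> C * real n powr (-1/2))"
proof -
  define u where "u = (\<chi> k. \<integral>x. l x $ k \<partial>P)"
  have X: "X i \<in> measurable M \<mu>" for i using indep by (simp add: indep_vars_def2)
  interpret P: prob_space P using prob_space_distr[OF X] distr by metis
  have sets: "sets P = sets \<mu>" by (metis distr sets_distr)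
  have meas: "(\<lambda>x. l x $ k) \<in> borel_measurable \<mu>" for k
    using sq[of k] by (simp add: sq_integrable_def measurable_cong_sets[OF sets refl])
  have intP: "integrable P (\<lambda>x. l x $ k)" "integrable P (\<lambda>x. (l x $ k)\<^sup>2)" for k
    using sq[of k] by (auto simp: sq_integrable_def intro: P.square_integrable_imp_integrable)
  define Y where "Y k i \<omega> = l (X i \<omega>) $ k - u $ k" for k i \<omega>
  have indepY: "indep_vars (\<lambda>_. borel) (Y k) UNIV" for k
    unfolding Y_def using meas
    by (intro indep_vars_compose2[OF indep, where N = "\<lambda>_. borel" and Y = "\<lambda>_ x. l x $ k - u $ k"]) auto
  have transfer: "integrable M (\<lambda>\<omega>. f (X i \<omega>)) \<longleftrightarrow> integrable P f"
    "expectation (\<lambda>\<omega>. f (X i \<omega>)) = (\<integral>x. f x \<partial>P)"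
    if "f \<in> borel_measurable \<mu>" for f :: "'x \<Rightarrow> real" and i
    using integrable_distr_eq[OF X that] integral_distr[OF X that] by (simp_all add: distr)
  define v where "v k = (\<integral>x. (l x $ k - u $ k)\<^sup>2 \<partial>P)" for k
  have intY: "integrable M (Y k i)" "integrable M (\<lambda>\<omega>. (Y k i \<omega>)\<^sup>2)"
    "expectation (Y k i) = 0" "expectation (\<lambda>\<omega>. (Y k i \<omega>)\<^sup>2) = v k" for k i
  proof -
    have m: "(\<lambda>x. l x $ k - u $ k) \<in> borel_measurable \<mu>" using meas by simp
    have u: "u $ k = (\<integral>x. l x $ k \<partial>P)" by (simp add: u_def)
    have Y: "Y k i = (\<lambda>\<omega>. l (X i \<omega>) $ k - u $ k)" by (simp add: Y_def fun_eq_iff)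
    show "integrable M (Y k i)" using transfer(1)[OF m, of i] intP by (simp add: Y)
    show "expectation (Y k i) = 0" using transfer(2)[OF m, of i] intP by (simp add: Y u P.prob_space)
    have m2: "(\<lambda>x. (l x $ k - u $ k)\<^sup>2) \<in> borel_measurable \<mu>" using meas by simp
    have "integrable P (\<lambda>x. (l x $ k - u $ k)\<^sup>2)"
      using intP by (simp add: power2_diff)
    then show "integrable M (\<lambda>\<omega>. (Y k i \<omega>)\<^sup>2)" "expectation (\<lambda>\<omega>. (Y k i \<omega>)\<^sup>2) = v k"
      using transfer[OF m2, of i] by (simp_all add: Y v_def)
  qed
  define T where "T n \<omega> = (\<Sum>k\<in>UNIV. (\<Sum>i<n. Y k i \<omega>)\<^sup>2)" for n \<omega>
  define V where "V = (\<Sum>k\<in>UNIV. v k)"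
  have intT: "integrable M (T n)" "expectation (T n) = real n * V" for n
    unfolding T_def V_def
    using square_centered_sum[OF indepY intY(1,2,3,4)]
    by (simp_all add: sum_distrib_left)
  have T_nonneg: "T n \<omega> \<ge> 0" for n \<omega> unfolding T_def by (intro sum_nonneg) simp
  have V: "V \<ge> 0" unfolding V_def v_def by (intro sum_nonneg) simp
  have T_eq: "(norm ((1 / real n) *\<^sub>R (\<Sum>i<n. l (X i \<omega>)) - u))\<^sup>2 = T n \<omega> / (real n)\<^sup>2" if "n > 0" for n \<omega>
  proof -
    have "(1 / real n) *\<^sub>R (\<Sum>i<n. l (X i \<omega>)) - u = (1 / real n) *\<^sub>R (\<Sum>i<n. l (X i \<omega>) - u)"
      using that by (simp add: sum_subtractf scaleR_diff_right sum_constant_scaleR del: sum_constant)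
    moreover have "(norm (\<Sum>i<n. l (X i \<omega>) - u))\<^sup>2 = T n \<omega>"
      by (simp add: norm_vec_def L2_set_def sum_nonneg T_def Y_def)
    ultimately show ?thesis by (simp add: power_mult_distrib power_divide)
  qed
  show ?thesis
    unfolding tight_P_def u_def[symmetric]
  proof (intro allI impI)
    fix \<epsilon> :: real assume "\<epsilon> > 0"
    show "\<exists>C\<^sub>0. \<forall>C\<ge>C\<^sub>0. \<forall>\<^sub>F n in sequentially. outer_measure_of M {\<omega> \<in> space M.
      \<not> norm ((1 / real n) *\<^sub>R (\<Sum>i<n. l (X i \<omega>)) - u) \<le> C * real n powr (-1/2)} \<le> ennreal \<epsilon>"
    \<comment> \<open>The square root makes V / C^2 at most \<epsilon>; the summand 1 keeps C
      positive when V is 0.\<close>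
    proof (intro exI[of _ "sqrt (V / \<epsilon>) + 1"] allI impI)
      fix C assume C: "sqrt (V / \<epsilon>) + 1 \<le> C"
      then have "C > 0" using V \<open>\<epsilon> > 0\<close> by (smt (verit) real_sqrt_ge_zero divide_nonneg_pos)
      have "sqrt (V / \<epsilon>) \<le> C" using C by simp
      then have "V / \<epsilon> \<le> C\<^sup>2" using \<open>C > 0\<close> by (simp add: real_sqrt_le_iff sqrt_le_D)
      then have VC: "V / C\<^sup>2 \<le> \<epsilon>" using \<open>C > 0\<close> \<open>\<epsilon> > 0\<close> by (simp add: field_simps)
      show "\<forall>\<^sub>F n in sequentially. outer_measure_of M {\<omega> \<in> space M.
        \<not> norm ((1 / real n) *\<^sub>R (\<Sum>i<n. l (X i \<omega>)) - u) \<le> C * real n powr (-1/2)} \<le> ennreal \<epsilon>"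
        using eventually_gt_at_top[of 0]
      proof eventually_elim
        case (elim n)
        let ?E = "{\<omega> \<in> space M. T n \<omega> \<ge> C\<^sup>2 * real n}"
        have T[measurable]: "T n \<in> borel_measurable M" using intT by blast
        have "\<omega> \<in> ?E" if "\<omega> \<in> space M"
          "\<not> norm ((1 / real n) *\<^sub>R (\<Sum>i<n. l (X i \<omega>)) - u) \<le> C * real n powr (-1/2)" for \<omega>
        proof -
          have "(C * real n powr (-1/2))\<^sup>2 \<le> (norm ((1 / real n) *\<^sub>R (\<Sum>i<n. l (X i \<omega>)) - u))\<^sup>2"
            using that(2) \<open>C > 0\<close> by (intro power_mono) auto
          moreover have "(real n powr (-1/2))\<^sup>2 = 1 / real n"
            using elim by (intro powr_half_neg_power2) simp
          ultimately have "C\<^sup>2 / real n \<le> T n \<omega> / (real n)\<^sup>2"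
            using elim by (simp add: T_eq power_mult_distrib)
          then show ?thesis using that(1) elim by (simp add: field_simps power2_eq_square)
        qed
        then have "outer_measure_of M {\<omega> \<in> space M.
          \<not> norm ((1 / real n) *\<^sub>R (\<Sum>i<n. l (X i \<omega>)) - u) \<le> C * real n powr (-1/2)} \<le> outer_measure_of M ?E"
          by (intro outer_measure_of_mono) auto
        also have "\<dots> = ennreal (prob ?E)" by (simp add: emeasure_eq_measure)
        also have "prob ?E \<le> expectation (T n) / (C\<^sup>2 * real n)"
          using elim \<open>C > 0\<close> intT
          by (intro integral_Markov_inequality_measure[where A = "space M"]) (auto simp: T_nonneg)
        also have "\<dots> = V / C\<^sup>2" using elim by (simp add: intT)
        finally show ?case using VC by (meson ennreal_leI order_trans)
      qed
    qed
  qed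
qed

subsection \<open>Stationary points and Newton steps of a random criterion\<close>

text \<open>\<open>G\<close> and \<open>H\<close> abstract the normalized gradient and Hessian, and
  \<open>A\<close> is c times the information matrix. Only the Taylor inequality ties
  \<open>H\<close> to \<open>G\<close>. It is stated for arbitrary pairs of points because its base
  point varies: the true parameter for the expansion of the maximizer, the current iterate for
  Newton steps and difference quotients.\<close>

locale smooth_criterion = prob_space M for M :: "'w measure" +
  fixes G :: "nat \<Rightarrow> 'w \<Rightarrow> real ^ 'd::finite \<Rightarrow> real ^ 'd"
    and H :: "nat \<Rightarrow> 'w \<Rightarrow> real ^ 'd \<Rightarrow> real ^ 'd ^ 'd"
    and \<theta>\<^sub>0 :: "real ^ 'd" and A :: "real ^ 'd ^ 'd"
    and \<theta>hat :: "nat \<Rightarrow> 'w \<Rightarrow> real ^ 'd" and lam :: "nat \<Rightarrow> 'w \<Rightarrow> real" and \<delta> :: real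
  assumes \<delta>: "\<delta> > 0"
    and taylor: "tight_P M (\<lambda>C n \<omega>. \<forall>x\<in>ball \<theta>\<^sub>0 \<delta>. \<forall>y\<in>ball \<theta>\<^sub>0 \<delta>.
      norm (G n \<omega> y - G n \<omega> x - H n \<omega> x *v (y - x)) \<le> C * (norm (y - x))\<^sup>2)"
    and hess_near: "tight_P M (\<lambda>C n \<omega>. \<forall>x\<in>ball \<theta>\<^sub>0 \<delta>.
      norm (H n \<omega> x + A) \<le> C * max (lam n \<omega>) (norm (x - \<theta>\<^sub>0)))"
    and root: "whp M (\<lambda>n \<omega>. G n \<omega> (\<theta>hat n \<omega>) = 0)"
    and consistent: "smallo_P M (\<lambda>n \<omega>. \<theta>hat n \<omega> - \<theta>\<^sub>0) (\<lambda>n \<omega>. 1)"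
    and invertible: "invertible A"
    and lam_pos: "\<And>n \<omega>. n \<ge> 1 \<Longrightarrow> \<omega> \<in> space M \<Longrightarrow> lam n \<omega> > 0"
    and lam_small: "smallo_P M lam (\<lambda>n \<omega>. real n powr (-1/4))"
begin

definition regular :: "real \<Rightarrow> nat \<Rightarrow> 'w \<Rightarrow> bool" where
  "regular C n \<omega> \<longleftrightarrow> (\<forall>x\<in>ball \<theta>\<^sub>0 \<delta>.
     norm (H n \<omega> x + A) \<le> C * max (lam n \<omega>) (norm (x - \<theta>\<^sub>0)) \<and>
     (\<forall>y\<in>ball \<theta>\<^sub>0 \<delta>. norm (G n \<omega> y - G n \<omega> x - H n \<omega> x *v (y - x)) \<le> C * (norm (y - x))\<^sup>2))"

text \<open>In contrast to \<open>regular\<close>, whose constant is dictated by tightness, this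
  event has probability tending to one for every \<epsilon>, so \<epsilon> can be adapted to that
  constant.\<close>

definition close :: "real \<Rightarrow> nat \<Rightarrow> 'w \<Rightarrow> bool" where
  "close \<epsilon> n \<omega> \<longleftrightarrow> G n \<omega> (\<theta>hat n \<omega>) = 0 \<and> \<theta>hat n \<omega> \<in> ball \<theta>\<^sub>0 \<delta> \<and>
     norm (\<theta>hat n \<omega> - \<theta>\<^sub>0) \<le> \<epsilon> \<and> lam n \<omega> \<le> \<epsilon> * real n powr (-1/4)"

lemma tight_regular: "tight_P M regular"
  by (rule tight_P_mono[OF tight_P_conj[OF taylor hess_near]]) (auto simp: regular_def)

lemma whp_close: "\<epsilon> > 0 \<Longrightarrow> whp M (close \<epsilon>)"
proof -
  assume "\<epsilon> > 0"
  \<comment> \<open>The bound \<delta>/2 is asked separately: \<epsilon> may exceed \<delta>, and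
    the ball is open.\<close>
  then have "whp M (\<lambda>n \<omega>. norm (\<theta>hat n \<omega> - \<theta>\<^sub>0) \<le> \<epsilon>)" "whp M (\<lambda>n \<omega>. norm (\<theta>hat n \<omega> - \<theta>\<^sub>0) \<le> \<delta>/2)"
    "whp M (\<lambda>n \<omega>. norm (lam n \<omega>) \<le> \<epsilon> * real n powr (-1/4))"
    using consistent lam_small half_gt_zero[OF \<delta>] unfolding smallo_P_def mult_1_right by blast+
  from whp_conj[OF whp_conj[OF this(1,2)] whp_conj[OF this(3) root]]
  show ?thesis
    by (rule whp_mono, intro always_eventually)
      (use \<delta> in \<open>auto simp: close_def dist_norm norm_minus_commute\<close>)
qed

lemma lam_le: "close \<epsilon> n \<omega> \<Longrightarrow> n \<ge> 1 \<Longrightarrow> \<epsilon> \<ge> 0 \<Longrightarrow> lam n \<omega> \<le> \<epsilon>"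
proof -
  assume *: "close \<epsilon> n \<omega>" "n \<ge> 1" "\<epsilon> \<ge> 0"
  have "real n powr (-1/4) \<le> 1" using *(2) powr_mono[of "-1/4" 0 "real n"] by simp
  then have "\<epsilon> * real n powr (-1/4) \<le> \<epsilon>" using *(3) by (simp add: mult_left_le)
  then show ?thesis using *(1) by (simp add: close_def)
qed

text \<open>This is where the exponent -1/4 matters for the rate: the error of order
  \<open>lam\<close> squared in the score does not exceed the stochastic order n^(-1/2).\<close>

lemma lam_square_le:
  assumes "close \<epsilon> n \<omega>" "n \<ge> 1" "\<omega> \<in> space M" "\<epsilon> \<le> 1"
  shows "(lam n \<omega>)\<^sup>2 \<le> real n powr (-1/2)"
proof -
  have "lam n \<omega> > 0" by (rule lam_pos) (use assms in auto)
  moreover have "lam n \<omega> \<le> \<epsilon> * real n powr (-1/4)" using assms(1) by (simp add: close_def)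
  moreover have "\<epsilon> * real n powr (-1/4) \<le> 1 * real n powr (-1/4)" using assms(4) by (intro mult_right_mono) auto
  ultimately have "(lam n \<omega>)\<^sup>2 \<le> (real n powr (-1/4))\<^sup>2" by (intro power_mono) auto
  also have "\<dots> = real n powr (-1/2)" by (simp add: power2_eq_square flip: powr_add)
  finally show ?thesis .
qed

text \<open>Taylor expansion at the true parameter, evaluated at the maximizer, where the gradient
  vanishes. At the base point the maximum in \<open>regular\<close> collapses to
  \<open>lam n \<omega>\<close>, as \<open>lam\<close> is positive; this gives the mixed
  term.\<close>

lemma score_expansion:
  assumes "regular C n \<omega>" "close \<epsilon> n \<omega>" "n \<ge> 1" "\<omega> \<in> space M"
  shows "norm (A *v (\<theta>hat n \<omega> - \<theta>\<^sub>0) - G n \<omega> \<theta>\<^sub>0) \<le>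
    C * (norm (\<theta>hat n \<omega> - \<theta>\<^sub>0))\<^sup>2 + C * lam n \<omega> * norm (\<theta>hat n \<omega> - \<theta>\<^sub>0)"
proof -
  let ?\<Delta> = "\<theta>hat n \<omega> - \<theta>\<^sub>0"
  have lam: "lam n \<omega> > 0" using lam_pos assms by auto
  have "\<theta>\<^sub>0 \<in> ball \<theta>\<^sub>0 \<delta>" using \<delta> by simp
  then have "norm (G n \<omega> (\<theta>hat n \<omega>) - G n \<omega> \<theta>\<^sub>0 - H n \<omega> \<theta>\<^sub>0 *v ?\<Delta>) \<le> C * (norm ?\<Delta>)\<^sup>2"
    "norm (H n \<omega> \<theta>\<^sub>0 + A) \<le> C * lam n \<omega>"
    using assms(1,2) lam unfolding regular_def close_def by (fastforce simp: max_def)+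
  moreover have "G n \<omega> (\<theta>hat n \<omega>) = 0" using assms(2) by (simp add: close_def)
  moreover have "norm ((H n \<omega> \<theta>\<^sub>0 + A) *v ?\<Delta>) \<le> norm (H n \<omega> \<theta>\<^sub>0 + A) * norm ?\<Delta>"
    by (rule norm_matrix_vector_mult_le)
  moreover have eq: "A *v ?\<Delta> - G n \<omega> \<theta>\<^sub>0 = (H n \<omega> \<theta>\<^sub>0 + A) *v ?\<Delta> + (0 - G n \<omega> \<theta>\<^sub>0 - H n \<omega> \<theta>\<^sub>0 *v ?\<Delta>)"
    by (simp add: matrix_vector_mult_add_rdistrib)
  moreover have "norm ((H n \<omega> \<theta>\<^sub>0 + A) *v ?\<Delta> + (0 - G n \<omega> \<theta>\<^sub>0 - H n \<omega> \<theta>\<^sub>0 *v ?\<Delta>)) \<le>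
      norm ((H n \<omega> \<theta>\<^sub>0 + A) *v ?\<Delta>) + norm (0 - G n \<omega> \<theta>\<^sub>0 - H n \<omega> \<theta>\<^sub>0 *v ?\<Delta>)"
    by (rule norm_triangle_ineq)
  moreover have "norm (H n \<omega> \<theta>\<^sub>0 + A) * norm ?\<Delta> \<le> C * lam n \<omega> * norm ?\<Delta>"
    by (rule mult_right_mono) (fact, simp)
  ultimately show ?thesis unfolding eq by simp
qed

lemma score_mean_zero:
  assumes score: "tight_P M (\<lambda>C n \<omega>. norm (G n \<omega> \<theta>\<^sub>0 - U n \<omega>) \<le> C * (lam n \<omega>)\<^sup>2)"
    and mean: "tight_P M (\<lambda>C n \<omega>. norm (U n \<omega> - u) \<le> C * real n powr (-1/2))"
  shows "u = 0"
proof (rule ccontr)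
  assume "u \<noteq> 0"
  \<comment> \<open>Three error terms carry the factor C (the error of the score, the quadratic
    remainder, the mixed term) and one carries the norm of A; together they are to use at most a
    quarter of the norm of u. The absolute value and the added 1 keep this positive for every
    C.\<close>
  define \<epsilon> where "\<epsilon> C = min 1 (norm u / (4 * (3 * \<bar>C\<bar> + norm A + 1)))" for C
  have \<epsilon>: "\<epsilon> C > 0" "\<epsilon> C \<le> 1" "\<epsilon> C * (3 * \<bar>C\<bar> + norm A) \<le> norm u / 4" for C
  proof -
    have "3 * \<bar>C\<bar> + norm A + 1 > 0" by (simp add: add_nonneg_pos)
    then show "\<epsilon> C > 0" "\<epsilon> C \<le> 1" using \<open>u \<noteq> 0\<close> by (auto simp: \<epsilon>_def)
    then have "\<epsilon> C * (3 * \<bar>C\<bar> + norm A) \<le> \<epsilon> C * (3 * \<bar>C\<bar> + norm A + 1)" by simp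
    also have "\<dots> \<le> norm u / (4 * (3 * \<bar>C\<bar> + norm A + 1)) * (3 * \<bar>C\<bar> + norm A + 1)"
      using \<open>3 * \<bar>C\<bar> + norm A + 1 > 0\<close> by (intro mult_right_mono) (auto simp: \<epsilon>_def)
    also have "\<dots> = norm u / 4" using \<open>3 * \<bar>C\<bar> + norm A + 1 > 0\<close> by (simp add: field_simps)
    finally show "\<epsilon> C * (3 * \<bar>C\<bar> + norm A) \<le> norm u / 4" .
  qed
  have "tight_P M (\<lambda>C n \<omega>. close (\<epsilon> C) n \<omega>)" by (intro tight_P_whpI whp_close \<epsilon>)
  note tight_P_conj[OF tight_P_conj[OF score mean] tight_P_conj[OF this tight_regular]]
  then obtain C where C: "C \<ge> 0" and ev: "\<forall>\<^sub>F n in sequentially. \<exists>\<omega>\<in>space M.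
      (norm (G n \<omega> \<theta>\<^sub>0 - U n \<omega>) \<le> C * (lam n \<omega>)\<^sup>2 \<and> norm (U n \<omega> - u) \<le> C * real n powr (-1/2)) \<and>
      close (\<epsilon> C) n \<omega> \<and> regular C n \<omega>"
    by (rule tight_P_ex[where C\<^sub>0 = 0]) blast
  have "(\<lambda>n. C * real n powr (-1/2)) \<longlonglongrightarrow> C * 0"
    by (intro tendsto_mult tendsto_const tendsto_neg_powr filterlim_real_sequentially) simp
  then have "\<forall>\<^sub>F n in sequentially. C * real n powr (-1/2) < norm u / 4"
    using \<open>u \<noteq> 0\<close> order_tendstoD(2)[of _ 0 _ "norm u / 4"] by simp
  with ev eventually_ge_at_top[of 1] have "\<forall>\<^sub>F n :: nat in sequentially. False"
  proof eventually_elim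
    case (elim n)
    then obtain \<omega> where \<omega>: "\<omega> \<in> space M" "norm (G n \<omega> \<theta>\<^sub>0 - U n \<omega>) \<le> C * (lam n \<omega>)\<^sup>2"
      "norm (U n \<omega> - u) \<le> C * real n powr (-1/2)" "close (\<epsilon> C) n \<omega>" "regular C n \<omega>" by blast
    let ?\<Delta> = "\<theta>hat n \<omega> - \<theta>\<^sub>0"
    have lam: "0 < lam n \<omega>" "lam n \<omega> \<le> \<epsilon> C"
      using lam_pos lam_le \<omega> elim(2) \<epsilon>(1)[of C] by auto
    have \<Delta>: "norm ?\<Delta> \<le> \<epsilon> C" using \<omega>(4) by (simp add: close_def)
    have sq: "(lam n \<omega>)\<^sup>2 \<le> \<epsilon> C" "(norm ?\<Delta>)\<^sup>2 \<le> \<epsilon> C" "lam n \<omega> * norm ?\<Delta> \<le> \<epsilon> C"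
      using lam \<Delta> \<epsilon>(1,2)[of C] mult_mono[of "lam n \<omega>" "\<epsilon> C" "lam n \<omega>" 1]
        mult_mono[of "norm ?\<Delta>" "\<epsilon> C" "norm ?\<Delta>" 1] mult_mono[of "lam n \<omega>" "\<epsilon> C" "norm ?\<Delta>" 1]
      by (auto simp: power2_eq_square)
    have "norm u \<le> norm (U n \<omega> - u) + norm (G n \<omega> \<theta>\<^sub>0 - U n \<omega>) +
        norm (A *v ?\<Delta> - G n \<omega> \<theta>\<^sub>0) + norm (A *v ?\<Delta>)" by norm
    also have "norm (A *v ?\<Delta>) \<le> norm A * \<epsilon> C"
      using norm_matrix_vector_mult_le[of A ?\<Delta>] mult_left_mono[OF \<Delta>, of "norm A"] by simp
    also have "norm (A *v ?\<Delta> - G n \<omega> \<theta>\<^sub>0) \<le> C * \<epsilon> C + C * \<epsilon> C"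
      using score_expansion[OF \<omega>(5,4) elim(2) \<omega>(1)] mult_left_mono[OF sq(2) C] mult_left_mono[OF sq(3) C]
      by (simp add: mult.assoc)
    also have "norm (G n \<omega> \<theta>\<^sub>0 - U n \<omega>) \<le> C * \<epsilon> C"
      using \<omega>(2) mult_left_mono[OF sq(1) C] by simp
    finally have "norm u \<le> norm (U n \<omega> - u) + \<epsilon> C * (3 * \<bar>C\<bar> + norm A)"
      using C by (simp add: algebra_simps)
    moreover have "norm u > 0" using \<open>u \<noteq> 0\<close> by simp
    ultimately show False using \<omega>(3) elim(3) \<epsilon>(3)[of C] by linarith
  qed
  then show False by simp
qed

text \<open>The invertibility of A bounds the error by its image, and the two terms of
  \<open>score_expansion\<close> that contain the error itself are absorbed on the left.\<close>

lemma root_n_rate: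
  assumes score: "tight_P M (\<lambda>C n \<omega>. norm (G n \<omega> \<theta>\<^sub>0 - U n \<omega>) \<le> C * (lam n \<omega>)\<^sup>2)"
    and U: "tight_P M (\<lambda>C n \<omega>. norm (U n \<omega>) \<le> C * real n powr (-1/2))"
  shows "bigo_P M (\<lambda>n \<omega>. \<theta>hat n \<omega> - \<theta>\<^sub>0) (\<lambda>n \<omega>. real n powr (-1/2))"
proof (rule bigo_PI[OF tight_P_conj[OF tight_regular tight_P_conj[OF score U]]])
  fix C :: real assume "C \<ge> 1"
  obtain m where m: "m > 0" "\<And>x. norm x \<le> m * norm (A *v x)"
    using invertible_lower_bound[OF invertible] by blast
  \<comment> \<open>With this radius each of the two absorbed terms is at most a quarter of the
    error, so half of the error remains on the left. The bound 1 is what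
    \<open>lam_square_le\<close> asks for.\<close>
  define \<epsilon> where "\<epsilon> = min 1 (1 / (4 * m * C))"
  have "1 / (4 * m * C) > 0" using m \<open>C \<ge> 1\<close> by simp
  then have \<epsilon>: "\<epsilon> > 0" "\<epsilon> \<le> 1" "\<epsilon> \<le> 1 / (4 * m * C)" by (auto simp: \<epsilon>_def)
  have \<epsilon>': "m * C * \<epsilon> \<le> 1/4"
    using mult_left_mono[OF \<epsilon>(3), of "m * C"] m \<open>C \<ge> 1\<close> by simp
  have "\<forall>\<^sub>F n in sequentially. \<forall>\<omega>\<in>space M. regular C n \<omega> \<and>
      norm (G n \<omega> \<theta>\<^sub>0 - U n \<omega>) \<le> C * (lam n \<omega>)\<^sup>2 \<and> norm (U n \<omega>) \<le> C * real n powr (-1/2) \<longrightarrow>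
      close \<epsilon> n \<omega> \<longrightarrow> norm (\<theta>hat n \<omega> - \<theta>\<^sub>0) \<le> 4 * m * C * real n powr (-1/2)"
    using eventually_ge_at_top[of 1]
  proof (eventually_elim, intro ballI impI, elim conjE)
    fix n :: nat and \<omega> assume n: "1 \<le> n" and \<omega>: "\<omega> \<in> space M" "regular C n \<omega>" "close \<epsilon> n \<omega>"
      and G: "norm (G n \<omega> \<theta>\<^sub>0 - U n \<omega>) \<le> C * (lam n \<omega>)\<^sup>2" and U: "norm (U n \<omega>) \<le> C * real n powr (-1/2)"
    let ?\<Delta> = "\<theta>hat n \<omega> - \<theta>\<^sub>0" and ?s = "real n powr (-1/2)"
    have "norm ?\<Delta> \<le> \<epsilon>" using \<omega> by (simp add: close_def)
    then have 1: "(norm ?\<Delta>)\<^sup>2 \<le> \<epsilon> * norm ?\<Delta>" by (simp add: power2_eq_square mult_right_mono)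
    have 2: "lam n \<omega> * norm ?\<Delta> \<le> \<epsilon> * norm ?\<Delta>"
      using lam_le[OF \<omega>(3) n] \<epsilon> by (simp add: mult_right_mono)
    have 3: "(lam n \<omega>)\<^sup>2 \<le> ?s" by (rule lam_square_le[OF \<omega>(3) n \<omega>(1) \<epsilon>(2)])
    have "norm (A *v ?\<Delta>) \<le> norm (A *v ?\<Delta> - G n \<omega> \<theta>\<^sub>0) + norm (G n \<omega> \<theta>\<^sub>0 - U n \<omega>) + norm (U n \<omega>)"
      by norm
    also have "\<dots> \<le> (C * (\<epsilon> * norm ?\<Delta>) + C * (\<epsilon> * norm ?\<Delta>)) + C * ?s + C * ?s"
      using score_expansion[OF \<omega>(2,3) n \<omega>(1)] G U \<open>C \<ge> 1\<close>
        mult_left_mono[OF 1, of C] mult_left_mono[OF 2, of C] mult_left_mono[OF 3, of C]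
      by (simp only: mult.assoc) linarith
    finally have "m * norm (A *v ?\<Delta>) \<le>
        m * ((C * (\<epsilon> * norm ?\<Delta>) + C * (\<epsilon> * norm ?\<Delta>)) + C * ?s + C * ?s)"
      using m(1) by simp
    also have "\<dots> = 2 * (m * C * \<epsilon>) * norm ?\<Delta> + 2 * m * C * ?s" by (simp add: algebra_simps)
    also have "\<dots> \<le> 2 * (1/4) * norm ?\<Delta> + 2 * m * C * ?s"
      by (intro add_right_mono mult_right_mono mult_left_mono \<epsilon>') auto
    finally show "norm ?\<Delta> \<le> 4 * m * C * ?s" using m(2)[of ?\<Delta>] by simp
  qed
  then show "\<exists>Q D. whp M Q \<and> (\<forall>\<^sub>F n in sequentially. \<forall>\<omega>\<in>space M. regular C n \<omega> \<and>
      norm (G n \<omega> \<theta>\<^sub>0 - U n \<omega>) \<le> C * (lam n \<omega>)\<^sup>2 \<and> norm (U n \<omega>) \<le> C * real n powr (-1/2) \<longrightarrow>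
      Q n \<omega> \<longrightarrow> norm (\<theta>hat n \<omega> - \<theta>\<^sub>0) \<le> D * real n powr (-1/2))"
    using whp_close[OF \<epsilon>(1)] by blast
qed

text \<open>Since n^(-1/2) is of order at most \<open>lam\<close>, the maximizer is within order
  \<open>lam\<close> of the truth, and both remainders in \<open>score_expansion\<close> become of
  order \<open>lam\<close> squared.\<close>

lemma estimator_expansion:
  assumes score: "tight_P M (\<lambda>C n \<omega>. norm (G n \<omega> \<theta>\<^sub>0 - U n \<omega>) \<le> C * (lam n \<omega>)\<^sup>2)"
    and rate: "bigo_P M (\<lambda>n \<omega>. \<theta>hat n \<omega> - \<theta>\<^sub>0) (\<lambda>n \<omega>. real n powr (-1/2))"
    and lam_large: "tight_P M (\<lambda>C n \<omega>. real n powr (-1/2) \<le> C * lam n \<omega>)"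
  shows "bigo_P M (\<lambda>n \<omega>. A *v (\<theta>hat n \<omega> - \<theta>\<^sub>0) - U n \<omega>) (\<lambda>n \<omega>. (lam n \<omega>)\<^sup>2)"
proof -
  have rate': "tight_P M (\<lambda>C n \<omega>. norm (\<theta>hat n \<omega> - \<theta>\<^sub>0) \<le> C * real n powr (-1/2))"
    using rate by (subst (asm) bigo_P_iff) auto
  show ?thesis
  proof (rule bigo_PI[OF tight_P_conj[OF tight_P_conj[OF tight_regular score] tight_P_conj[OF rate' lam_large]]])
    fix C :: real assume "C \<ge> 1"
    have "\<forall>\<^sub>F n in sequentially. \<forall>\<omega>\<in>space M.
        (regular C n \<omega> \<and> norm (G n \<omega> \<theta>\<^sub>0 - U n \<omega>) \<le> C * (lam n \<omega>)\<^sup>2) \<and>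
        norm (\<theta>hat n \<omega> - \<theta>\<^sub>0) \<le> C * real n powr (-1/2) \<and> real n powr (-1/2) \<le> C * lam n \<omega> \<longrightarrow>
        close 1 n \<omega> \<longrightarrow>
        norm (A *v (\<theta>hat n \<omega> - \<theta>\<^sub>0) - U n \<omega>) \<le> (C ^ 5 + C ^ 3 + C) * (lam n \<omega>)\<^sup>2"
      using eventually_ge_at_top[of 1]
    proof (eventually_elim, intro ballI impI, elim conjE)
      fix n :: nat and \<omega> assume n: "1 \<le> n" and \<omega>: "\<omega> \<in> space M" "regular C n \<omega>" "close 1 n \<omega>"
        and G: "norm (G n \<omega> \<theta>\<^sub>0 - U n \<omega>) \<le> C * (lam n \<omega>)\<^sup>2"
        and \<Delta>: "norm (\<theta>hat n \<omega> - \<theta>\<^sub>0) \<le> C * real n powr (-1/2)" and s: "real n powr (-1/2) \<le> C * lam n \<omega>"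
      let ?\<Delta> = "\<theta>hat n \<omega> - \<theta>\<^sub>0"
      have lam: "lam n \<omega> > 0" using lam_pos n \<omega>(1) by auto
      have le: "norm ?\<Delta> \<le> C ^ 2 * lam n \<omega>"
        using order_trans[OF \<Delta> mult_left_mono[OF s, of C]] \<open>C \<ge> 1\<close>
        by (simp add: power2_eq_square mult.assoc)
      have "norm (A *v ?\<Delta> - U n \<omega>) \<le> norm (A *v ?\<Delta> - G n \<omega> \<theta>\<^sub>0) + norm (G n \<omega> \<theta>\<^sub>0 - U n \<omega>)" by norm
      also have "\<dots> \<le> (C * (norm ?\<Delta>)\<^sup>2 + C * lam n \<omega> * norm ?\<Delta>) + C * (lam n \<omega>)\<^sup>2"
        using score_expansion[OF \<omega>(2,3) n \<omega>(1)] G by simp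
      also have "\<dots> \<le> (C * (C ^ 2 * lam n \<omega>)\<^sup>2 + C * lam n \<omega> * (C ^ 2 * lam n \<omega>)) + C * (lam n \<omega>)\<^sup>2"
        using le lam \<open>C \<ge> 1\<close> by (intro add_mono mult_left_mono power_mono) auto
      also have "\<dots> = (C ^ 5 + C ^ 3 + C) * (lam n \<omega>)\<^sup>2" by (simp add: algebra_simps power_numeral_reduce)
      finally show "norm (A *v ?\<Delta> - U n \<omega>) \<le> (C ^ 5 + C ^ 3 + C) * (lam n \<omega>)\<^sup>2" .
    qed
    then show "\<exists>Q D. whp M Q \<and> (\<forall>\<^sub>F n in sequentially. \<forall>\<omega>\<in>space M.
        (regular C n \<omega> \<and> norm (G n \<omega> \<theta>\<^sub>0 - U n \<omega>) \<le> C * (lam n \<omega>)\<^sup>2) \<and>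
        norm (\<theta>hat n \<omega> - \<theta>\<^sub>0) \<le> C * real n powr (-1/2) \<and> real n powr (-1/2) \<le> C * lam n \<omega> \<longrightarrow>
        Q n \<omega> \<longrightarrow> norm (A *v (\<theta>hat n \<omega> - \<theta>\<^sub>0) - U n \<omega>) \<le> D * (lam n \<omega>)\<^sup>2)"
      using whp_close[of 1] by (intro exI[of _ "close 1"] exI[of _ "C ^ 5 + C ^ 3 + C"]) simp
  qed
qed

text \<open>With e the current error, the new error is the inverse of J applied to (J + H) e + (G -
  H e). The first summand measures the quality of the information matrix; the second is a Taylor
  remainder, because the gradient vanishes at the maximizer. J stays in the neighborhood of A where
  inverses are uniformly bounded.\<close>

lemma newton_step:
  assumes info: "tight_P M (\<lambda>C n \<omega>. \<forall>x\<in>ball \<theta>\<^sub>0 (\<delta>/2). norm (J n \<omega> x + H n \<omega> x) \<le> C * a n)"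
    and a: "a \<longlonglongrightarrow> 0" "\<And>n. a n \<ge> 0"
    and error: "bigo_P M (\<lambda>n \<omega>. x n \<omega> - \<theta>hat n \<omega>) (\<lambda>n \<omega>. real n powr (- r))" and "r > 0"
    and r': "r' \<le> 2 * r" "\<And>n. n \<ge> 1 \<Longrightarrow> a n * real n powr (- r) \<le> real n powr (- r')"
  shows "bigo_P M (\<lambda>n \<omega>. x n \<omega> + matrix_inv (J n \<omega> (x n \<omega>)) *v G n \<omega> (x n \<omega>) - \<theta>hat n \<omega>)
    (\<lambda>n \<omega>. real n powr (- r'))"
proof -
  have error': "tight_P M (\<lambda>C n \<omega>. norm (x n \<omega> - \<theta>hat n \<omega>) \<le> C * real n powr (- r))"
    using error by (subst (asm) bigo_P_iff) auto
  obtain \<rho> K where \<rho>: "\<rho> > 0" "K > 0" "\<And>B. norm (B - A) \<le> \<rho> \<Longrightarrow> Finite_Cartesian_Product.invertible B"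
    "\<And>B x. norm (B - A) \<le> \<rho> \<Longrightarrow> norm (matrix_inv B *v x) \<le> K * norm x"
    using invertible_perturb[OF invertible] by blast
  show ?thesis
  proof (rule bigo_PI[OF tight_P_conj[OF tight_regular tight_P_conj[OF info error']]])
    fix C :: real assume "C \<ge> 1"
    \<comment> \<open>The iterate is then within 2 \<epsilon> of the true parameter, which lies
      inside the ball of radius \<delta>/2 and moves H from -A by at most \<rho>/2. Another \<rho>/4
      is reserved for the distance between J and -H.\<close>
    define \<epsilon> where "\<epsilon> = min (\<delta>/8) (\<rho> / (4 * C))"
    have "\<rho> / (4 * C) > 0" using \<rho> \<open>C \<ge> 1\<close> by simp
    then have \<epsilon>: "\<epsilon> > 0" "\<epsilon> \<le> \<delta>/8" "\<epsilon> \<le> \<rho> / (4 * C)" using \<delta> by (auto simp: \<epsilon>_def)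
    have C\<epsilon>: "C * \<epsilon> \<le> \<rho>/4" using mult_left_mono[OF \<epsilon>(3), of C] \<open>C \<ge> 1\<close> by simp
    have "(\<lambda>n. C * real n powr (- r)) \<longlonglongrightarrow> C * 0"
      using \<open>r > 0\<close> by (intro tendsto_mult tendsto_const tendsto_neg_powr filterlim_real_sequentially) simp
    then have ev1: "\<forall>\<^sub>F n in sequentially. C * real n powr (- r) < \<epsilon>"
      using \<epsilon>(1) order_tendstoD(2)[of _ 0 _ \<epsilon>] by simp
    have "(\<lambda>n. C * a n) \<longlonglongrightarrow> C * 0" by (intro tendsto_mult tendsto_const a)
    then have ev2: "\<forall>\<^sub>F n in sequentially. C * a n < \<rho>/4"
      using \<rho>(1) order_tendstoD(2)[of _ 0 _ "\<rho>/4"] by simp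
    have "\<forall>\<^sub>F n in sequentially. \<forall>\<omega>\<in>space M.
        regular C n \<omega> \<and> (\<forall>x\<in>ball \<theta>\<^sub>0 (\<delta>/2). norm (J n \<omega> x + H n \<omega> x) \<le> C * a n) \<and>
        norm (x n \<omega> - \<theta>hat n \<omega>) \<le> C * real n powr (- r) \<longrightarrow> close \<epsilon> n \<omega> \<longrightarrow>
        norm (x n \<omega> + matrix_inv (J n \<omega> (x n \<omega>)) *v G n \<omega> (x n \<omega>) - \<theta>hat n \<omega>) \<le>
        K * (C ^ 2 + C ^ 3) * real n powr (- r')"
      using ev1 ev2 eventually_ge_at_top[of 1]
    proof (eventually_elim, intro ballI impI, elim conjE)
      fix n :: nat and \<omega>
      assume small: "C * real n powr (- r) < \<epsilon>" "C * a n < \<rho>/4" and n: "1 \<le> n"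
        and \<omega>: "\<omega> \<in> space M" "regular C n \<omega>" "close \<epsilon> n \<omega>"
        and J: "\<forall>x\<in>ball \<theta>\<^sub>0 (\<delta>/2). norm (J n \<omega> x + H n \<omega> x) \<le> C * a n"
        and e: "norm (x n \<omega> - \<theta>hat n \<omega>) \<le> C * real n powr (- r)"
      define y e where "y = x n \<omega>" and "e = x n \<omega> - \<theta>hat n \<omega>"
      have close: "norm (\<theta>hat n \<omega> - \<theta>\<^sub>0) \<le> \<epsilon>" "G n \<omega> (\<theta>hat n \<omega>) = 0" "\<theta>hat n \<omega> \<in> ball \<theta>\<^sub>0 \<delta>"
        using \<omega>(3) by (auto simp: close_def)
      have lam: "lam n \<omega> \<le> \<epsilon>" using lam_le[OF \<omega>(3) n] \<epsilon> by simp
      have "norm (y - \<theta>\<^sub>0) \<le> norm e + norm (\<theta>hat n \<omega> - \<theta>\<^sub>0)" unfolding y_def e_def by norm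
      also have "\<dots> \<le> \<epsilon> + \<epsilon>" using e small(1) close by (simp add: e_def)
      finally have y\<epsilon>: "norm (y - \<theta>\<^sub>0) \<le> 2 * \<epsilon>" by simp
      then have y: "y \<in> ball \<theta>\<^sub>0 (\<delta>/2)" "y \<in> ball \<theta>\<^sub>0 \<delta>"
        using \<epsilon>(2) \<delta> by (auto simp: dist_norm norm_minus_commute)
      have JH: "norm (J n \<omega> y + H n \<omega> y) \<le> C * a n" using J y(1) by blast
      have "norm (H n \<omega> y + A) \<le> C * max (lam n \<omega>) (norm (y - \<theta>\<^sub>0))"
        using \<omega>(2) y(2) by (simp add: regular_def)
      also have "\<dots> \<le> C * (2 * \<epsilon>)" using lam y\<epsilon> \<epsilon>(1) \<open>C \<ge> 1\<close> by (intro mult_left_mono) auto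
      finally have HA: "norm (H n \<omega> y + A) \<le> \<rho>/2" using C\<epsilon> by simp
      have "norm (J n \<omega> y - A) \<le> norm (J n \<omega> y + H n \<omega> y) + norm (H n \<omega> y + A)" by norm
      then have inv: "norm (J n \<omega> y - A) \<le> \<rho>" using JH HA small(2) \<rho>(1) by simp
      note JI = matrix_inv_vector_mult[OF \<rho>(3)[OF inv]]
      let ?z = "(J n \<omega> y + H n \<omega> y) *v e + (G n \<omega> y - H n \<omega> y *v e)"
      have "J n \<omega> y *v e + G n \<omega> y = ?z" by (simp add: matrix_vector_mult_add_rdistrib)
      then have eq: "y + matrix_inv (J n \<omega> y) *v G n \<omega> y - \<theta>hat n \<omega> = matrix_inv (J n \<omega> y) *v ?z"
        using JI(2)[of e] by (metis (no_types, lifting) e_def y_def add_diff_eq diff_add_eq matrix_vector_right_distrib)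
      \<comment> \<open>The expansion is based at the iterate, not at the maximizer, because J
        approximates the Hessian there.\<close>
      have "norm (G n \<omega> (\<theta>hat n \<omega>) - G n \<omega> y - H n \<omega> y *v (\<theta>hat n \<omega> - y)) \<le> C * (norm (\<theta>hat n \<omega> - y))\<^sup>2"
        using \<omega>(2) y(2) close(3) by (simp add: regular_def)
      moreover have "G n \<omega> (\<theta>hat n \<omega>) - G n \<omega> y - H n \<omega> y *v (\<theta>hat n \<omega> - y) = - (G n \<omega> y - H n \<omega> y *v e)"
        by (simp add: close e_def y_def matrix_vector_mult_diff_distrib)
      ultimately have "norm (G n \<omega> y - H n \<omega> y *v e) \<le> C * (norm e)\<^sup>2"
        by (simp only: norm_minus_cancel) (simp add: e_def y_def norm_minus_commute)
      moreover have "norm ((J n \<omega> y + H n \<omega> y) *v e) \<le> C * a n * norm e"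
        by (rule order_trans[OF norm_matrix_vector_mult_le mult_right_mono]) (use JH in auto)
      ultimately have "norm ?z \<le> C * a n * norm e + C * (norm e)\<^sup>2"
        using norm_triangle_ineq[of "(J n \<omega> y + H n \<omega> y) *v e" "G n \<omega> y - H n \<omega> y *v e"] by simp
      also have "\<dots> \<le> C * a n * (C * real n powr (- r)) + C * (C * real n powr (- r))\<^sup>2"
        using e a(2)[of n] \<open>C \<ge> 1\<close> by (intro add_mono mult_left_mono power_mono) (auto simp: e_def)
      also have "\<dots> = C ^ 2 * (a n * real n powr (- r)) + C ^ 3 * real n powr (- (2 * r))"
        by (simp add: power2_eq_square power3_eq_cube flip: powr_add)
      also have "\<dots> \<le> C ^ 2 * real n powr (- r') + C ^ 3 * real n powr (- r')"
        using r' n \<open>C \<ge> 1\<close> by (intro add_mono mult_left_mono powr_mono) auto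
      finally have "K * norm ?z \<le> K * (C ^ 2 * real n powr (- r') + C ^ 3 * real n powr (- r'))"
        using \<rho>(2) by simp
      then have "norm (matrix_inv (J n \<omega> y) *v ?z) \<le> K * (C ^ 2 + C ^ 3) * real n powr (- r')"
        using \<rho>(4)[OF inv, of ?z] by (simp add: algebra_simps)
      then show "norm (x n \<omega> + matrix_inv (J n \<omega> (x n \<omega>)) *v G n \<omega> (x n \<omega>) - \<theta>hat n \<omega>) \<le>
          K * (C ^ 2 + C ^ 3) * real n powr (- r')"
        by (simp only: eq flip: y_def)
    qed
    then show "\<exists>Q D. whp M Q \<and> (\<forall>\<^sub>F n in sequentially. \<forall>\<omega>\<in>space M.
        regular C n \<omega> \<and> (\<forall>x\<in>ball \<theta>\<^sub>0 (\<delta>/2). norm (J n \<omega> x + H n \<omega> x) \<le> C * a n) \<and>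
        norm (x n \<omega> - \<theta>hat n \<omega>) \<le> C * real n powr (- r) \<longrightarrow> Q n \<omega> \<longrightarrow>
        norm (x n \<omega> + matrix_inv (J n \<omega> (x n \<omega>)) *v G n \<omega> (x n \<omega>) - \<theta>hat n \<omega>) \<le>
        D * real n powr (- r'))"
      using whp_close[OF \<epsilon>(1)] by blast
  qed
qed

text \<open>The starting value is measured against the true parameter, the iterates against the
  maximizer. As the maximizer is itself within order n^(-1/2) of the truth and \<open>r 0\<close> is
  at most 1/2, changing the center preserves the initial rate.\<close>

lemma newton_iterate_rate:
  assumes info: "tight_P M (\<lambda>C n \<omega>. \<forall>x\<in>ball \<theta>\<^sub>0 (\<delta>/2). norm (J n \<omega> x + H n \<omega> x) \<le> C * a n)"
    and a: "a \<longlonglongrightarrow> 0" "\<And>n. a n \<ge> 0"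
    and init: "bigo_P M (\<lambda>n \<omega>. \<theta>init n \<omega> - \<theta>\<^sub>0) (\<lambda>n \<omega>. real n powr (- r 0))" "r 0 \<le> 1/2"
    and rate: "bigo_P M (\<lambda>n \<omega>. \<theta>hat n \<omega> - \<theta>\<^sub>0) (\<lambda>n \<omega>. real n powr (-1/2))"
    and r: "\<And>k. r k > 0" "\<And>k. r (Suc k) \<le> 2 * r k"
    and ar: "\<And>n k. n \<ge> 1 \<Longrightarrow> a n * real n powr (- r k) \<le> real n powr (- r (Suc k))"
  shows "bigo_P M (\<lambda>n \<omega>. newton_iterate (J n \<omega>) (G n \<omega>) (\<theta>init n \<omega>) k - \<theta>hat n \<omega>)
    (\<lambda>n \<omega>. real n powr (- r k))"
proof (induction k)
  case 0
  have "tight_P M (\<lambda>C n \<omega>. norm (\<theta>init n \<omega> - \<theta>\<^sub>0) \<le> C * real n powr (- r 0))"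
    "tight_P M (\<lambda>C n \<omega>. norm (\<theta>hat n \<omega> - \<theta>\<^sub>0) \<le> C * real n powr (-1/2))"
    using init(1) rate by (subst (asm) bigo_P_iff; force)+
  note both = tight_P_conj[OF this]
  have "tight_P M (\<lambda>C n \<omega>. norm (\<theta>init n \<omega> - \<theta>hat n \<omega>) \<le> C * real n powr (- r 0))"
  proof (rule tight_P_rescale[OF both, of 2])
    fix C :: real assume "C \<ge> 0"
    show "\<forall>\<^sub>F n in sequentially. \<forall>\<omega>\<in>space M. norm (\<theta>init n \<omega> - \<theta>\<^sub>0) \<le> C * real n powr (- r 0) \<and>
        norm (\<theta>hat n \<omega> - \<theta>\<^sub>0) \<le> C * real n powr (-1/2) \<longrightarrow>
        norm (\<theta>init n \<omega> - \<theta>hat n \<omega>) \<le> (2 * C) * real n powr (- r 0)"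
      using eventually_ge_at_top[of 1]
    proof (eventually_elim, intro ballI impI, elim conjE)
      fix n :: nat and \<omega> assume "1 \<le> n" and *: "norm (\<theta>init n \<omega> - \<theta>\<^sub>0) \<le> C * real n powr (- r 0)"
        "norm (\<theta>hat n \<omega> - \<theta>\<^sub>0) \<le> C * real n powr (-1/2)"
      have "C * real n powr (-1/2) \<le> C * real n powr (- r 0)"
        using \<open>1 \<le> n\<close> \<open>C \<ge> 0\<close> init(2) by (intro mult_left_mono powr_mono) auto
      moreover have "norm (\<theta>init n \<omega> - \<theta>hat n \<omega>) \<le> norm (\<theta>init n \<omega> - \<theta>\<^sub>0) + norm (\<theta>hat n \<omega> - \<theta>\<^sub>0)" by norm
      ultimately show "norm (\<theta>init n \<omega> - \<theta>hat n \<omega>) \<le> (2 * C) * real n powr (- r 0)" using * by simp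
    qed
  qed simp
  then show ?case by (simp add: bigo_P_iff)
next
  case (Suc k)
  show ?case
    using newton_step[OF info a Suc r(1) r(2) ar] by simp
qed

text \<open>Each shifted gradient has a Taylor error of order h^2 with h = n^(-1/2), and the
  difference quotient divides by a multiple of h, leaving order h. The base point is restricted to
  half the radius so that the shifted points still lie in the ball of radius \<delta> for large
  n.\<close>

lemma discretized_hessian:
  assumes "t1 < t2"
  shows "tight_P M (\<lambda>C n \<omega>. \<forall>x\<in>ball \<theta>\<^sub>0 (\<delta>/2). norm ((\<chi> i j.
      - ((G n \<omega> (x + (real n powr (-1/2) * t2) *\<^sub>R axis j 1) $ i
          - G n \<omega> (x + (real n powr (-1/2) * t1) *\<^sub>R axis j 1) $ i) / (real n powr (-1/2) * (t2 - t1))))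
      + H n \<omega> x) \<le> C * real n powr (-1/2))"
    (is "tight_P M (\<lambda>C n \<omega>. \<forall>x\<in>ball \<theta>\<^sub>0 (\<delta>/2). norm (?J n \<omega> x + H n \<omega> x) \<le> C * ?h n)")
proof (rule tight_P_rescale[OF tight_regular])
  \<comment> \<open>Sum of the two Taylor errors over the step length, with the powers of h removed.
    It is positive, as t1 < t2 prevents both shifts from being 0.\<close>
  define L where "L = (t1\<^sup>2 + t2\<^sup>2) / (t2 - t1)"
  have "t1\<^sup>2 + t2\<^sup>2 > 0" using assms by (simp add: sum_power2_gt_zero_iff)
  then have "L > 0" using assms by (simp add: L_def)
  then show "real CARD('d) * real CARD('d) * L > 0" by simp
  fix C :: real assume "C \<ge> 0"
  have "(\<lambda>n. ?h n * \<bar>t\<bar>) \<longlonglongrightarrow> 0 * \<bar>t\<bar>" for t :: real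
    by (intro tendsto_mult tendsto_const tendsto_neg_powr filterlim_real_sequentially) simp
  then have ev: "\<forall>\<^sub>F n in sequentially. ?h n * \<bar>t\<bar> < \<delta>/2" for t :: real
    using \<delta> order_tendstoD(2)[of "\<lambda>n. ?h n * \<bar>t\<bar>" 0 sequentially "\<delta>/2"] by simp
  show "\<forall>\<^sub>F n in sequentially. \<forall>\<omega>\<in>space M. regular C n \<omega> \<longrightarrow>
      (\<forall>x\<in>ball \<theta>\<^sub>0 (\<delta>/2). norm (?J n \<omega> x + H n \<omega> x) \<le> (real CARD('d) * real CARD('d) * L * C) * ?h n)"
    using ev[of t1] ev[of t2] eventually_ge_at_top[of 1]
  proof (eventually_elim, intro ballI impI)
    fix n :: nat and \<omega> x
    assume small: "?h n * \<bar>t1\<bar> < \<delta>/2" "?h n * \<bar>t2\<bar> < \<delta>/2" and n: "1 \<le> n"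
      and reg: "regular C n \<omega>" and x: "x \<in> ball \<theta>\<^sub>0 (\<delta>/2)"
    have h: "?h n > 0" using n by simp
    have xb: "x \<in> ball \<theta>\<^sub>0 \<delta>" using x \<delta> by simp
    have shift: "norm (G n \<omega> (x + (?h n * t) *\<^sub>R axis j 1) - G n \<omega> x - (?h n * t) *\<^sub>R (H n \<omega> x *v axis j 1))
        \<le> C * (?h n * t)\<^sup>2" if "?h n * \<bar>t\<bar> < \<delta>/2" for t j
    proof -
      let ?y = "x + (?h n * t) *\<^sub>R axis j 1"
      have "norm (?y - \<theta>\<^sub>0) \<le> norm (x - \<theta>\<^sub>0) + ?h n * \<bar>t\<bar>"
        using norm_triangle_ineq[of "x - \<theta>\<^sub>0" "(?h n * t) *\<^sub>R axis j 1"] h by (simp add: abs_mult algebra_simps)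
      also have "\<dots> < \<delta>/2 + \<delta>/2" using x that by (intro add_strict_mono) (auto simp: dist_norm norm_minus_commute)
      finally have "?y \<in> ball \<theta>\<^sub>0 \<delta>" by (simp add: dist_norm norm_minus_commute)
      then have "norm (G n \<omega> ?y - G n \<omega> x - H n \<omega> x *v (?y - x)) \<le> C * (norm (?y - x))\<^sup>2"
        using reg xb unfolding regular_def by blast
      then show ?thesis by (simp add: matrix_vector_mult_scaleR power_mult_distrib)
    qed
    have "\<bar>(?J n \<omega> x + H n \<omega> x) $ i $ j\<bar> \<le> L * C * ?h n" for i j
    proof -
      let ?g = "\<lambda>t. G n \<omega> (x + (?h n * t) *\<^sub>R axis j 1) $ i"
      have comp: "\<bar>?g t - G n \<omega> x $ i - ?h n * t * H n \<omega> x $ i $ j\<bar> \<le> C * (?h n * t)\<^sup>2"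
        if "?h n * \<bar>t\<bar> < \<delta>/2" for t
        using order_trans[OF component_le_norm_cart[of _ i] shift[OF that, of j]]
        by (simp add: matrix_vector_mul_component inner_axis)
      have "\<bar>?g t2 - ?g t1 - ?h n * (t2 - t1) * H n \<omega> x $ i $ j\<bar> \<le> C * (?h n * t2)\<^sup>2 + C * (?h n * t1)\<^sup>2"
        using comp[OF small(1)] comp[OF small(2)] by (simp add: algebra_simps abs_le_iff)
      also have "\<dots> = (L * C * ?h n) * (?h n * (t2 - t1))"
        using assms by (simp add: L_def power2_eq_square field_simps)
      finally have "\<bar>?g t2 - ?g t1 - ?h n * (t2 - t1) * H n \<omega> x $ i $ j\<bar> / (?h n * (t2 - t1)) \<le> L * C * ?h n"
        using h assms by (subst pos_divide_le_eq) auto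
      moreover have "(?J n \<omega> x + H n \<omega> x) $ i $ j =
          - ((?g t2 - ?g t1 - ?h n * (t2 - t1) * H n \<omega> x $ i $ j) / (?h n * (t2 - t1)))"
        using h assms by (simp add: diff_divide_distrib)
      moreover have "?h n * (t2 - t1) > 0" using h assms by simp
      ultimately show ?thesis by (simp only: abs_minus_cancel abs_divide abs_of_pos)
    qed
    then have "norm (?J n \<omega> x + H n \<omega> x) \<le> real CARD('d) * real CARD('d) * (L * C * ?h n)"
      by (rule norm_matrix_le)
    then show "norm (?J n \<omega> x + H n \<omega> x) \<le> (real CARD('d) * real CARD('d) * L * C) * ?h n"
      by (simp add: mult.assoc)
  qed
qed

end

subsection \<open>Convergence exponents\<close>

lemma less_int_gt: "x < real (int_gt x)"
  unfolding int_gt_def by (rule LeastI_ex) (rule reals_Archimedean2)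

lemma le_int_ge: "x \<le> real (int_ge x)"
  unfolding int_ge_def by (rule LeastI_ex) (rule real_arch_simple)

lemma less_int_geD: "k < int_ge x \<Longrightarrow> real k < x"
  unfolding int_ge_def by (metis not_less_Least not_le)

lemma log2_le_iff: "y > 0 \<Longrightarrow> ln y / ln 2 \<le> real k \<longleftrightarrow> y \<le> 2 ^ k" for y :: real
  by (subst pos_divide_le_eq, simp) (metis ln_le_cancel_iff ln_realpow zero_less_numeral zero_less_power)

lemma log2_less_iff: "y > 0 \<Longrightarrow> ln y / ln 2 < real k \<longleftrightarrow> y < 2 ^ k" for y :: real
  by (subst pos_divide_less_eq, simp) (metis ln_less_cancel_iff ln_realpow zero_less_numeral zero_less_power)

lemma log2_gt_iff: "y > 0 \<Longrightarrow> real k < ln y / ln 2 \<longleftrightarrow> 2 ^ k < y" for y :: real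
  using log2_le_iff[of y k] by linarith

lemma strict_mono_power_rate: "\<psi> > 0 \<Longrightarrow> strict_mono (\<lambda>k. 2 ^ k * \<psi>)" for \<psi> :: real
  by (simp add: strict_mono_Suc_iff)

lemma filterlim_power_rate: "\<psi> > 0 \<Longrightarrow> filterlim (\<lambda>k. 2 ^ k * \<psi>) at_top sequentially" for \<psi> :: real
  by (rule filterlim_at_top_mult_tendsto_pos[OF tendsto_const])
    (auto intro!: filterlim_at_top_mono[OF filterlim_real_sequentially] always_eventually
      less_imp_le of_nat_less_two_power)

text \<open>The strict inequality in \<open>int_gt\<close> is what turns a bound into o_P. In the
  borderline case \<psi> = 1/2 the logarithm is 0 and one step is taken.\<close>

lemma power_rate_int_gt:
  fixes \<psi> :: real
  assumes "\<psi> > 0"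
  shows "2 ^ int_gt (ln (1 / (2 * \<psi>)) / ln 2) * \<psi> > 1/2"
proof -
  have "1 / (2 * \<psi>) < 2 ^ int_gt (ln (1 / (2 * \<psi>)) / ln 2)"
    using less_int_gt[of "ln (1 / (2 * \<psi>)) / ln 2"] assms by (subst (asm) log2_less_iff) auto
  then show ?thesis using assms by (simp add: field_simps)
qed

section \<open>Exponents of the discretized iteration\<close>

context
  fixes \<psi> g :: real
  assumes g: "g > 0" "g \<le> 1/2" and \<psi>: "1/2 - g < \<psi>" "\<psi> \<le> 1/2"
begin

text \<open>The map has the fixed point 1/2 - g, and each step doubles the distance to it. The
  condition on \<psi> places the starting exponent strictly above the fixed point.\<close>

lemma R1_Suc: "R1 \<psi> g (Suc k) = 2 * R1 \<psi> g k - (1/2 - g)"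
  by (simp add: R1_def algebra_simps)

lemma R1_less: "R1 \<psi> g k < R1 \<psi> g (Suc k)"
  using \<psi> by (simp add: R1_def)

lemma R1_pos: "R1 \<psi> g k > 0"
  using g \<psi> by (simp add: R1_def add_nonneg_pos)

text \<open>Together with \<open>R1_L1\<close> this identifies \<open>L1\<close> as the first index
  at which \<open>R1\<close> reaches 1/2: that happens exactly when 2^k (\<psi> + g - 1/2) is at
  least g.\<close>

lemma R1_less_half: "k < L1 \<psi> g \<Longrightarrow> R1 \<psi> g k < 1/2"
proof -
  assume "k < L1 \<psi> g"
  then have "2 ^ k < g / (g + \<psi> - 1/2)"
    unfolding L1_def using g \<psi> by (subst log2_gt_iff[symmetric]) (auto dest: less_int_geD)
  then have "2 ^ k * (g + \<psi> - 1/2) < g" using \<psi> by (simp add: pos_less_divide_eq)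
  then show ?thesis by (simp add: R1_def algebra_simps)
qed

lemma R1_L1: "R1 \<psi> g (L1 \<psi> g) \<ge> 1/2"
proof -
  have "g / (g + \<psi> - 1/2) \<le> 2 ^ L1 \<psi> g"
    unfolding L1_def using g \<psi> by (subst log2_le_iff[symmetric]) (auto intro: le_int_ge)
  then have "g \<le> 2 ^ L1 \<psi> g * (g + \<psi> - 1/2)" using \<psi> by (simp add: pos_divide_le_eq)
  then show ?thesis by (simp add: R1_def algebra_simps)
qed

lemma R_le: "k \<le> L1 \<psi> g \<Longrightarrow> R \<psi> g k = R1 \<psi> g k"
  by (simp add: R_def)

lemma R_ge: "k \<ge> L1 \<psi> g \<Longrightarrow> R \<psi> g k = R1 \<psi> g (L1 \<psi> g) + (real k - real (L1 \<psi> g)) * g"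
  by (cases "k = L1 \<psi> g") (auto simp: R_def R2_def of_nat_diff)

lemma R_Suc_ge: "k \<ge> L1 \<psi> g \<Longrightarrow> R \<psi> g (Suc k) = R \<psi> g k + g"
  by (simp add: R_ge algebra_simps)

lemma R_Suc_less: "k < L1 \<psi> g \<Longrightarrow> R \<psi> g (Suc k) = 2 * R \<psi> g k - (1/2 - g)"
  by (simp add: R_le R1_Suc)

lemma R_0: "R \<psi> g 0 = \<psi>"
  by (simp add: R_le R1_def)

lemma R_pos: "R \<psi> g k > 0"
proof (cases "k \<le> L1 \<psi> g")
  case False
  then have "(real k - real (L1 \<psi> g)) * g \<ge> 0" using g by simp
  then show ?thesis using False R1_pos[of "L1 \<psi> g"] by (simp add: R_ge)
qed (simp add: R_le R1_pos)

lemma R_half_le: "k \<ge> L1 \<psi> g \<Longrightarrow> R \<psi> g k \<ge> 1/2"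
proof -
  assume "k \<ge> L1 \<psi> g"
  moreover from this have "(real k - real (L1 \<psi> g)) * g \<ge> 0" using g by simp
  ultimately show ?thesis using R1_L1 by (simp add: R_ge)
qed

text \<open>Doubling and adding 1/2 agree at 1/2; below it doubling is the stricter limit, above it
  the addition. \<open>R\<close> changes regime exactly there: before \<open>L1\<close> it doubles
  up to a loss of 1/2 - g, afterwards it adds only g, which is at most 1/2.\<close>

lemma R_Suc_le: "R \<psi> g (Suc k) \<le> 2 * R \<psi> g k" "R \<psi> g (Suc k) \<le> R \<psi> g k + 1/2"
proof -
  have "R \<psi> g (Suc k) \<le> 2 * R \<psi> g k \<and> R \<psi> g (Suc k) \<le> R \<psi> g k + 1/2"
  proof (cases "k < L1 \<psi> g")
    case True
    then show ?thesis using R_Suc_less[OF True] R1_less_half[OF True] R_le[of k] g by simp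
  next
    case False
    then show ?thesis using R_Suc_ge[of k] R_half_le[of k] g by simp
  qed
  then show "R \<psi> g (Suc k) \<le> 2 * R \<psi> g k" "R \<psi> g (Suc k) \<le> R \<psi> g k + 1/2" by auto
qed

lemma strict_mono_R: "strict_mono (R \<psi> g)"
  unfolding strict_mono_Suc_iff
proof
  fix k show "R \<psi> g k < R \<psi> g (Suc k)"
    using R_Suc_ge[of k] R1_less[of k] g by (cases "k < L1 \<psi> g") (auto simp: R_le)
qed

lemma filterlim_R: "filterlim (R \<psi> g) at_top sequentially"
proof (rule filterlim_at_top_mono)
  show "filterlim (\<lambda>k. R1 \<psi> g (L1 \<psi> g) - real (L1 \<psi> g) * g + real k * g) at_top sequentially"
    using g by (intro filterlim_tendsto_add_at_top[OF tendsto_const]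
      filterlim_at_top_mult_tendsto_pos[OF tendsto_const] filterlim_real_sequentially)
  show "\<forall>\<^sub>F k in sequentially. R1 \<psi> g (L1 \<psi> g) - real (L1 \<psi> g) * g + real k * g \<le> R \<psi> g k"
    using eventually_ge_at_top[of "L1 \<psi> g"] by eventually_elim (simp add: R_ge algebra_simps)
qed

text \<open>The second case arises when the logarithm is an integer: then the exponent at
  \<open>L1\<close> may equal 1/2, and the additional linear step is what makes it strictly
  larger.\<close>

lemma R_int_gt: "R \<psi> g (int_gt (ln (g / (g + \<psi> - 1/2)) / ln 2)) > 1/2"
proof -
  let ?k = "int_gt (ln (g / (g + \<psi> - 1/2)) / ln 2)"
  show ?thesis
  proof (cases "?k \<le> L1 \<psi> g")
    case True
    have "g / (g + \<psi> - 1/2) < 2 ^ ?k"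
      using less_int_gt[of "ln (g / (g + \<psi> - 1/2)) / ln 2"] g \<psi> by (subst (asm) log2_less_iff) auto
    then have "g < 2 ^ ?k * (g + \<psi> - 1/2)" using \<psi> by (simp add: pos_divide_less_eq)
    then show ?thesis using True by (simp add: R_le R1_def algebra_simps)
  next
    case False
    then have "R \<psi> g (L1 \<psi> g) < R \<psi> g ?k" using strict_mono_R by (simp add: strict_mono_less)
    then show ?thesis using R_half_le[of "L1 \<psi> g"] by simp
  qed
qed

end

section \<open>Comparison of rates and the range of g\<close>

lemma bigo_P_imp_smallo_P:
  assumes "bigo_P M Y (\<lambda>n \<omega>. real n powr (- r))" "r > s"
  shows "smallo_P M Y (\<lambda>n \<omega>. real n powr (- s))"
  unfolding smallo_P_def whp_iff
proof (intro allI impI)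
  fix \<epsilon> \<eta> :: real assume "\<epsilon> > 0" "\<eta> > 0"
  with assms(1) obtain C where C: "\<forall>\<^sub>F n in sequentially.
      outer_measure_of M {\<omega> \<in> space M. norm (Y n \<omega>) > C * real n powr (- r)} \<le> ennreal \<eta>"
    unfolding bigo_P_def by blast
  have "(\<lambda>n. C * real n powr (s - r)) \<longlonglongrightarrow> C * 0"
    using assms(2) by (intro tendsto_mult tendsto_const tendsto_neg_powr filterlim_real_sequentially) simp
  then have "\<forall>\<^sub>F n in sequentially. C * real n powr (s - r) < \<epsilon>"
    using \<open>\<epsilon> > 0\<close> order_tendstoD(2)[of _ 0 _ \<epsilon>] by simp
  with C show "\<forall>\<^sub>F n in sequentially.
      outer_measure_of M {\<omega> \<in> space M. \<not> norm (Y n \<omega>) \<le> \<epsilon> * real n powr (- s)} \<le> ennreal \<eta>"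
  proof eventually_elim
    case (elim n)
    have "C * real n powr (- r) = C * real n powr (s - r) * real n powr (- s)"
      by (simp flip: powr_add)
    also have "\<dots> \<le> \<epsilon> * real n powr (- s)" using elim(2) by (intro mult_right_mono) auto
    finally have "{\<omega> \<in> space M. \<not> norm (Y n \<omega>) \<le> \<epsilon> * real n powr (- s)} \<subseteq>
        {\<omega> \<in> space M. norm (Y n \<omega>) > C * real n powr (- r)}" by auto
    then show ?case using elim(1) outer_measure_of_mono order_trans by blast
  qed
qed

lemma smallo_P_imp_bigo_P: "smallo_P M Y r \<Longrightarrow> bigo_P M Y r"
proof -
  assume "smallo_P M Y r"
  then have "whp M (\<lambda>n \<omega>. norm (Y n \<omega>) \<le> 1 * r n \<omega>)" unfolding smallo_P_def by (blast intro: zero_less_one)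
  then show ?thesis unfolding whp_iff bigo_P_def by (auto simp: not_le intro!: exI[of _ 1])
qed

text \<open>The product of \<open>lam\<close> and its inverse is 1, yet the two bounds make it at
  most C^2 n^(b - g), which tends to 0 if g > b. One sample point for each large n gives the
  contradiction.\<close>

lemma (in prob_space) maximal_rate_le:
  assumes max: "maximal_rate M lam g" and inv: "bigo_P M (\<lambda>n \<omega>. inverse (lam n \<omega>)) (\<lambda>n \<omega>. real n powr b)"
    and pos: "\<And>n \<omega>. n \<ge> 1 \<Longrightarrow> \<omega> \<in> space M \<Longrightarrow> lam n \<omega> > 0"
  shows "g \<le> b"
proof (rule ccontr)
  assume "\<not> g \<le> b"
  have "tight_P M (\<lambda>C n \<omega>. norm (lam n \<omega>) \<le> C * real n powr (- g))"
    using max unfolding maximal_rate_def by (subst (asm) bigo_P_iff) auto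
  moreover have "tight_P M (\<lambda>C n \<omega>. norm (inverse (lam n \<omega>)) \<le> C * real n powr b)"
    using inv by (subst (asm) bigo_P_iff) auto
  ultimately obtain C where C: "C \<ge> 0" "\<forall>\<^sub>F n in sequentially. \<exists>\<omega>\<in>space M.
      norm (lam n \<omega>) \<le> C * real n powr (- g) \<and> norm (inverse (lam n \<omega>)) \<le> C * real n powr b"
    by (rule tight_P_ex[OF tight_P_conj, where C\<^sub>0 = 0])
  have "(\<lambda>n. C * C * real n powr (b - g)) \<longlonglongrightarrow> C * C * 0"
    using \<open>\<not> g \<le> b\<close> by (intro tendsto_mult tendsto_const tendsto_neg_powr filterlim_real_sequentially) simp
  then have "\<forall>\<^sub>F n in sequentially. C * C * real n powr (b - g) < 1"
    using order_tendstoD(2)[of "\<lambda>n. C * C * real n powr (b - g)" 0 sequentially 1] by simp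
  with C(2) eventually_ge_at_top[of 1] have "\<forall>\<^sub>F n :: nat in sequentially. False"
  proof eventually_elim
    case (elim n)
    then obtain \<omega> where \<omega>: "\<omega> \<in> space M" "norm (lam n \<omega>) \<le> C * real n powr (- g)"
      "norm (inverse (lam n \<omega>)) \<le> C * real n powr b" by blast
    have "1 = norm (lam n \<omega>) * norm (inverse (lam n \<omega>))"
      using pos[OF elim(2) \<omega>(1)] by (simp flip: abs_mult)
    also have "\<dots> \<le> (C * real n powr (- g)) * (C * real n powr b)" using \<omega> C(1) by (intro mult_mono) auto
    also have "\<dots> = C * C * (real n powr (- g) * real n powr b)" by simp
    also have "real n powr (- g) * real n powr b = real n powr (b - g)" by (simp flip: powr_add)
    finally show False using elim(3) by simp
  qed
  then show False by simp
qed

text \<open>The exponent a is itself admissible in the definition of g. Equality can occur: n^(-a) /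
  log n is of smaller order than n^(-a), but not O(n^(-g')) for any g' > a.\<close>

lemma maximal_rate_ge:
  assumes "maximal_rate M lam g" "smallo_P M lam (\<lambda>n \<omega>. real n powr (- a))"
  shows "a \<le> g"
  using assms smallo_P_imp_bigo_P unfolding maximal_rate_def by blast

section \<open>Square integrability of the efficient score\<close>

lemma sq_integrable_diff:
  assumes "sq_integrable P f" "sq_integrable P h"
  shows "sq_integrable P (\<lambda>x. f x - h x)"
  unfolding sq_integrable_def
proof
  have m[measurable]: "f \<in> borel_measurable P" "h \<in> borel_measurable P"
    using assms by (auto simp: sq_integrable_def)
  show "(\<lambda>x. f x - h x) \<in> borel_measurable P" by measurable
  have "integrable P (\<lambda>x. 2 * (f x)\<^sup>2 + 2 * (h x)\<^sup>2)"
    using assms by (auto simp: sq_integrable_def)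
  then show "integrable P (\<lambda>x. (f x - h x)\<^sup>2)"
  proof (rule Bochner_Integration.integrable_bound)
    show "AE x in P. norm ((f x - h x)\<^sup>2) \<le> norm (2 * (f x)\<^sup>2 + 2 * (h x)\<^sup>2)"
    proof (rule AE_I2)
      fix x show "norm ((f x - h x)\<^sup>2) \<le> norm (2 * (f x)\<^sup>2 + 2 * (h x)\<^sup>2)"
        using zero_le_power2[of "f x + h x"] zero_le_power2[of "f x - h x"]
        by (simp only: real_norm_def abs_of_nonneg) (simp add: power2_diff power2_sum)
    qed
  qed measurable
qed

lemma sq_integrable_efficient_score:
  assumes "is_efficient_score \<mu> lik \<H> \<theta>\<^sub>0 \<eta>\<^sub>0 l"
  shows "sq_integrable (model_dist \<mu> lik \<theta>\<^sub>0 \<eta>\<^sub>0) (\<lambda>x. l x $ i)"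
proof -
  let ?P = "model_dist \<mu> lik \<theta>\<^sub>0 \<eta>\<^sub>0"
  obtain s k where s: "is_theta_score \<mu> lik \<theta>\<^sub>0 \<eta>\<^sub>0 s"
    and k: "(\<lambda>x. k x $ i) \<in> L2_closed_span ?P (nuisance_scores \<mu> lik \<H> \<theta>\<^sub>0 \<eta>\<^sub>0)"
    and l: "\<And>x. x \<in> space ?P \<Longrightarrow> l x = s x - k x"
    using assms unfolding is_efficient_score_def Let_def is_L2_projection_def by metis
  have "sq_integrable ?P (\<lambda>x. s x $ i - k x $ i)"
    using s k by (intro sq_integrable_diff) (auto simp: is_theta_score_def L2_closed_span_def)
  moreover have "sq_integrable ?P (\<lambda>x. l x $ i) \<longleftrightarrow> sq_integrable ?P (\<lambda>x. s x $ i - k x $ i)"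
    unfolding sq_integrable_def using l
    by (intro arg_cong2[where f = conj] measurable_cong Bochner_Integration.integrable_cong) auto
  ultimately show ?thesis by simp
qed

subsection \<open>Penalized profile likelihood\<close>

theorem theorem5:
  fixes M :: "'w measure" and \<mu> :: "'x measure"
    and \<Theta> :: "(real ^ 'd::finite) set" and Z :: "real set" and m :: nat
    and lik :: "('d, 'x) likelihood"
    and \<theta>\<^sub>0 :: "real ^ 'd" and \<eta>\<^sub>0 :: "real \<Rightarrow> real"
    and X :: "nat \<Rightarrow> 'w \<Rightarrow> 'x" and lam :: "nat \<Rightarrow> 'w \<Rightarrow> real"
    and \<eta>hat :: "nat \<Rightarrow> 'w \<Rightarrow> real ^ 'd \<Rightarrow> real \<Rightarrow> real"
    and S :: "nat \<Rightarrow> 'w \<Rightarrow> real ^ 'd \<Rightarrow> ereal" and Sr :: "nat \<Rightarrow> 'w \<Rightarrow> real ^ 'd \<Rightarrow> real"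
    and \<theta>hat :: "nat \<Rightarrow> 'w \<Rightarrow> real ^ 'd"
    and l0 :: "'x \<Rightarrow> real ^ 'd" and I0 :: "real ^ 'd ^ 'd"
  assumes "compact Z" and "m \<ge> 1"
    and "semiparametric_model \<mu> \<Theta> (sobolev_class Z m) lik"
    and "\<theta>\<^sub>0 \<in> \<Theta>" and "\<eta>\<^sub>0 \<in> sobolev_class Z m"
    and "prob_space M"
    and "prob_space.indep_vars M (\<lambda>_. \<mu>) X UNIV"
    and "\<And>i. distr M \<mu> (X i) = model_dist \<mu> lik \<theta>\<^sub>0 \<eta>\<^sub>0"
    and "\<And>n \<omega>. n \<ge> 1 \<Longrightarrow> \<omega> \<in> space M \<Longrightarrow> lam n \<omega> > 0"
    and "smallo_P M lam (\<lambda>n \<omega>. real n powr (-1/4))"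
    and "bigo_P M (\<lambda>n \<omega>. inverse (lam n \<omega>)) (\<lambda>n \<omega>. real n powr (real m / (2 * real m + 1)))"
    and "\<And>n \<omega> \<theta>. n \<ge> 1 \<Longrightarrow> \<omega> \<in> space M \<Longrightarrow> \<theta> \<in> \<Theta> \<Longrightarrow>
           is_maximizer (pen_log_lik Z m lik (\<lambda>i. X i \<omega>) n (lam n \<omega>) \<theta>) (sobolev_class Z m) (\<eta>hat n \<omega> \<theta>)"
    and "S = (\<lambda>n \<omega> \<theta>. pen_log_lik Z m lik (\<lambda>i. X i \<omega>) n (lam n \<omega>) \<theta> (\<eta>hat n \<omega> \<theta>))"
    and "Sr = (\<lambda>n \<omega> \<theta>. real_of_ereal (S n \<omega> \<theta>))"
    and "\<And>n \<omega>. n \<ge> 1 \<Longrightarrow> \<omega> \<in> space M \<Longrightarrow> is_maximizer (S n \<omega>) \<Theta> (\<theta>hat n \<omega>)"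
    and "is_efficient_score \<mu> lik (sobolev_class Z m) \<theta>\<^sub>0 \<eta>\<^sub>0 l0"
    and "I0 = covariance_matrix (model_dist \<mu> lik \<theta>\<^sub>0 \<eta>\<^sub>0) l0"
    and "condition_G' M \<Theta> X lam S \<theta>\<^sub>0 l0 I0"
    and "smallo_P M (\<lambda>n \<omega>. \<theta>hat n \<omega> - \<theta>\<^sub>0) (\<lambda>n \<omega>. 1)"
    and "invertible I0"
  shows "bigo_P M
           (\<lambda>n \<omega>. sqrt (real n) *\<^sub>R (\<theta>hat n \<omega> - \<theta>\<^sub>0)
              - (1 / sqrt (real n)) *\<^sub>R (\<Sum>i<n. matrix_inv I0 *v l0 (X i \<omega>)))
           (\<lambda>n \<omega>. sqrt (real n) * (lam n \<omega>)\<^sup>2)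
       \<and> (\<forall>g. maximal_rate M lam g \<longrightarrow>
            1/4 \<le> g \<and> g \<le> real m / (2 * real m + 1) \<and>
            (\<forall>\<psi> (\<theta>init :: nat \<Rightarrow> 'w \<Rightarrow> real ^ 'd).
               1/2 - g < \<psi> \<and> \<psi> \<le> 1/2 \<and>
               bigo_P M (\<lambda>n \<omega>. \<theta>init n \<omega> - \<theta>\<^sub>0) (\<lambda>n \<omega>. real n powr (- \<psi>)) \<longrightarrow>
               errors_of_increasing_order M
                 (\<lambda>n \<omega> k. iterate_I n (Sr n \<omega>) (\<theta>init n \<omega>) k - \<theta>hat n \<omega>) \<psi> (\<lambda>k. 2 ^ k * \<psi>) \<and>
               smallo_P M
                 (\<lambda>n \<omega>. iterate_I n (Sr n \<omega>) (\<theta>init n \<omega>) (int_gt (ln (1 / (2 * \<psi>)) / ln 2)) - \<theta>hat n \<omega>)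
                 (\<lambda>n \<omega>. real n powr (-1/2)) \<and>
               (\<forall>t1 t2. t1 < t2 \<longrightarrow>
                  errors_of_increasing_order M
                    (\<lambda>n \<omega> k. iterate_II t1 t2 n (Sr n \<omega>) (\<theta>init n \<omega>) k - \<theta>hat n \<omega>) \<psi> (R \<psi> g) \<and>
                  smallo_P M
                    (\<lambda>n \<omega>. iterate_II t1 t2 n (Sr n \<omega>) (\<theta>init n \<omega>)
                              (int_gt (ln (g / (g + \<psi> - 1/2)) / ln 2)) - \<theta>hat n \<omega>)
                    (\<lambda>n \<omega>. real n powr (-1/2)))))"
proof -
  interpret prob_space M by (rule assms(6))
  note lam_pos = assms(9) and lam_small = assms(10) and lam_inv = assms(11)
  obtain c N where "c \<noteq> 0" and N: "open N" "\<theta>\<^sub>0 \<in> N" "N \<subseteq> \<Theta>"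
    and regular: "whp M (\<lambda>n \<omega>. (\<forall>\<theta>\<in>N. \<bar>S n \<omega> \<theta>\<bar> \<noteq> \<infinity>) \<and> three_times_differentiable_on (Sr n \<omega>) N)"
    and score: "bigo_P M (\<lambda>n \<omega>. (1 / real n) *\<^sub>R grad (Sr n \<omega>) \<theta>\<^sub>0
        - c *\<^sub>R ((1 / real n) *\<^sub>R (\<Sum>i<n. l0 (X i \<omega>)))) (\<lambda>n \<omega>. (lam n \<omega>)\<^sup>2)"
    and second: "bigo_P_uniformly M N (\<lambda>n \<omega> \<theta>. (1 / real n) *\<^sub>R hess (Sr n \<omega>) \<theta> + c *\<^sub>R I0)
        (\<lambda>n \<omega> \<theta>. max (lam n \<omega>) (norm (\<theta> - \<theta>\<^sub>0)))"
    and third: "bigo_P_uniformly M N (\<lambda>n \<omega> \<theta>. (1 / real n) *\<^sub>R third_deriv (Sr n \<omega>) \<theta>) (\<lambda>n \<omega> \<theta>. 1)"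
    using assms(18) unfolding condition_G'_def Let_def assms(14)[symmetric] by blast
  \<comment> \<open>\<open>N\<close> is merely open, while the Taylor estimate needs a convex
    set.\<close>
  obtain \<delta> where \<delta>: "\<delta> > 0" "ball \<theta>\<^sub>0 \<delta> \<subseteq> N"
    using N open_contains_ball by blast
  define G where "G n \<omega> \<theta> = (1 / real n) *\<^sub>R grad (Sr n \<omega>) \<theta>" for n \<omega> \<theta>
  define H where "H n \<omega> \<theta> = (1 / real n) *\<^sub>R hess (Sr n \<omega>) \<theta>" for n \<omega> \<theta>
  interpret smooth_criterion M G H \<theta>\<^sub>0 "c *\<^sub>R I0" \<theta>hat lam \<delta>
  proof
    have "tight_P M (\<lambda>C n \<omega>. \<forall>\<theta>\<in>N. norm ((1 / real n) *\<^sub>R third_deriv (Sr n \<omega>) \<theta>) \<le> C * 1)"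
      using third by (subst (asm) bigo_P_uniformly_iff) auto
    from tight_P_conj[OF this regular[unfolded whp_iff_tight_P]]
    show "tight_P M (\<lambda>C n \<omega>. \<forall>x\<in>ball \<theta>\<^sub>0 \<delta>. \<forall>y\<in>ball \<theta>\<^sub>0 \<delta>.
        norm (G n \<omega> y - G n \<omega> x - H n \<omega> x *v (y - x)) \<le> C * (norm (y - x))\<^sup>2)"
    proof (rule tight_P_rescale[where C\<^sub>1 = 0])
      show "real CARD('d) ^ 3 > 0" by simp
      fix C :: real
      show "\<forall>\<^sub>F n in sequentially. \<forall>\<omega>\<in>space M.
          (\<forall>\<theta>\<in>N. norm ((1 / real n) *\<^sub>R third_deriv (Sr n \<omega>) \<theta>) \<le> C * 1) \<and>
          (\<forall>\<theta>\<in>N. \<bar>S n \<omega> \<theta>\<bar> \<noteq> \<infinity>) \<and> three_times_differentiable_on (Sr n \<omega>) N \<longrightarrow>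
          (\<forall>x\<in>ball \<theta>\<^sub>0 \<delta>. \<forall>y\<in>ball \<theta>\<^sub>0 \<delta>.
            norm (G n \<omega> y - G n \<omega> x - H n \<omega> x *v (y - x)) \<le> (real CARD('d) ^ 3 * C) * (norm (y - x))\<^sup>2)"
        using eventually_ge_at_top[of 1]
      proof (eventually_elim, intro ballI impI, elim conjE)
        fix n :: nat and \<omega> x y assume n: "1 \<le> n" and x: "x \<in> ball \<theta>\<^sub>0 \<delta>" and y: "y \<in> ball \<theta>\<^sub>0 \<delta>"
          and T: "\<forall>\<theta>\<in>N. norm ((1 / real n) *\<^sub>R third_deriv (Sr n \<omega>) \<theta>) \<le> C * 1"
          and diff: "three_times_differentiable_on (Sr n \<omega>) N"
        have "norm (third_deriv (Sr n \<omega>) \<theta>) \<le> real n * C" if "\<theta> \<in> ball \<theta>\<^sub>0 \<delta>" for \<theta>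
        proof -
          have "norm ((1 / real n) *\<^sub>R third_deriv (Sr n \<omega>) \<theta>) \<le> C" using T that \<delta>(2) by fastforce
          then show ?thesis using n by (simp add: field_simps)
        qed
        moreover have "three_times_differentiable_on (Sr n \<omega>) (ball \<theta>\<^sub>0 \<delta>)"
          using diff \<delta>(2) unfolding three_times_differentiable_on_def by blast
        ultimately have le: "norm (grad (Sr n \<omega>) y - grad (Sr n \<omega>) x - hess (Sr n \<omega>) x *v (y - x)) \<le>
            real CARD('d) ^ 3 * (real n * C) * (norm (y - x))\<^sup>2"
          using x y by (intro grad_taylor[where S = "ball \<theta>\<^sub>0 \<delta>"]) auto
        have "norm (G n \<omega> y - G n \<omega> x - H n \<omega> x *v (y - x)) =
            (1 / real n) * norm (grad (Sr n \<omega>) y - grad (Sr n \<omega>) x - hess (Sr n \<omega>) x *v (y - x))"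
          by (simp add: G_def H_def scaleR_matrix_vector_assoc[symmetric] flip: scaleR_diff_right)
        also have "\<dots> \<le> (1 / real n) * (real CARD('d) ^ 3 * (real n * C) * (norm (y - x))\<^sup>2)"
          using le by (rule mult_left_mono) simp
        also have "\<dots> = (real CARD('d) ^ 3 * C) * (norm (y - x))\<^sup>2" using n by simp
        finally show "norm (G n \<omega> y - G n \<omega> x - H n \<omega> x *v (y - x)) \<le>
            (real CARD('d) ^ 3 * C) * (norm (y - x))\<^sup>2" .
      qed
    qed
    have "tight_P M (\<lambda>C n \<omega>. \<forall>x\<in>N. norm ((1 / real n) *\<^sub>R hess (Sr n \<omega>) x + c *\<^sub>R I0) \<le>
        C * max (lam n \<omega>) (norm (x - \<theta>\<^sub>0)))"
      using second by (subst (asm) bigo_P_uniformly_iff) (auto simp: le_max_iff_disj)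
    then show "tight_P M (\<lambda>C n \<omega>. \<forall>x\<in>ball \<theta>\<^sub>0 \<delta>. norm (H n \<omega> x + c *\<^sub>R I0) \<le>
        C * max (lam n \<omega>) (norm (x - \<theta>\<^sub>0)))"
      by (rule tight_P_mono[where C\<^sub>1 = 0], intro always_eventually) (use \<delta>(2) in \<open>auto simp: H_def\<close>)
    have "whp M (\<lambda>n \<omega>. norm (\<theta>hat n \<omega> - \<theta>\<^sub>0) \<le> \<delta>/2 * 1)"
      using assms(19) half_gt_zero[OF \<delta>(1)] unfolding smallo_P_def by blast
    from whp_conj[OF this regular] show "whp M (\<lambda>n \<omega>. G n \<omega> (\<theta>hat n \<omega>) = 0)"
    proof (rule whp_mono)
      show "\<forall>\<^sub>F n in sequentially. \<forall>\<omega>\<in>space M. norm (\<theta>hat n \<omega> - \<theta>\<^sub>0) \<le> \<delta>/2 * 1 \<and>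
          (\<forall>\<theta>\<in>N. \<bar>S n \<omega> \<theta>\<bar> \<noteq> \<infinity>) \<and> three_times_differentiable_on (Sr n \<omega>) N \<longrightarrow>
          G n \<omega> (\<theta>hat n \<omega>) = 0"
        using eventually_ge_at_top[of 1]
      proof (eventually_elim, intro ballI impI, elim conjE)
        fix n :: nat and \<omega> assume n: "1 \<le> n" and \<omega>: "\<omega> \<in> space M" "norm (\<theta>hat n \<omega> - \<theta>\<^sub>0) \<le> \<delta>/2 * 1"
          and fin: "\<forall>\<theta>\<in>N. \<bar>S n \<omega> \<theta>\<bar> \<noteq> \<infinity>" and diff: "three_times_differentiable_on (Sr n \<omega>) N"
        have hat: "\<theta>hat n \<omega> \<in> N" using \<omega>(2) \<delta> by (auto simp: dist_norm norm_minus_commute)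
        have "Sr n \<omega> \<theta> \<le> Sr n \<omega> (\<theta>hat n \<omega>)" if "\<theta> \<in> N" for \<theta>
        proof -
          have "S n \<omega> \<theta> \<le> S n \<omega> (\<theta>hat n \<omega>)"
            using assms(15)[OF n \<omega>(1)] that N(3) by (auto simp: is_maximizer_def)
          \<comment> \<open>Finiteness matters: \<open>real_of_ereal\<close> sends both infinities
            to 0 and would not preserve the order.\<close>
          moreover have "\<bar>S n \<omega> \<theta>\<bar> \<noteq> \<infinity>" "\<bar>S n \<omega> (\<theta>hat n \<omega>)\<bar> \<noteq> \<infinity>" using fin that hat by auto
          ultimately show ?thesis unfolding assms(14)
            by (cases "S n \<omega> \<theta>"; cases "S n \<omega> (\<theta>hat n \<omega>)") auto
        qed
        then have "grad (Sr n \<omega>) (\<theta>hat n \<omega>) = 0"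
          using diff hat N(1) unfolding three_times_differentiable_on_def
          by (intro grad_eq_0_at_max[where S = N]) auto
        then show "G n \<omega> (\<theta>hat n \<omega>) = 0" by (simp add: G_def)
      qed
    qed
    show "invertible (c *\<^sub>R I0)" using assms(20) \<open>c \<noteq> 0\<close> by (rule scalar_invertible[rotated])
  qed (use \<delta> lam_pos lam_small assms(19) in auto)

  \<comment> \<open>Rate and linearization of the maximizer\<close>
  let ?P = "model_dist \<mu> lik \<theta>\<^sub>0 \<eta>\<^sub>0"
  define U where "U n \<omega> = c *\<^sub>R ((1 / real n) *\<^sub>R (\<Sum>i<n. l0 (X i \<omega>)))" for n \<omega>
  define u where "u = c *\<^sub>R (\<chi> k. \<integral>x. l0 x $ k \<partial>?P)"
  have score': "tight_P M (\<lambda>C n \<omega>. norm (G n \<omega> \<theta>\<^sub>0 - U n \<omega>) \<le> C * (lam n \<omega>)\<^sup>2)"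
    using score by (subst (asm) bigo_P_iff) (auto simp: G_def U_def)
  have mean: "tight_P M (\<lambda>C n \<omega>. norm (U n \<omega> - u) \<le> C * real n powr (-1/2))"
  proof (rule tight_P_rescale[where C\<^sub>1 = 0])
    show "tight_P M (\<lambda>C n \<omega>. norm ((1 / real n) *\<^sub>R (\<Sum>i<n. l0 (X i \<omega>)) - (\<chi> k. \<integral>x. l0 x $ k \<partial>?P))
        \<le> C * real n powr (-1/2))"
      by (rule iid_mean_tight[OF assms(7,8) sq_integrable_efficient_score[OF assms(16)]])
    show "\<bar>c\<bar> > 0" using \<open>c \<noteq> 0\<close> by simp
  qed (intro always_eventually,
      auto simp: U_def u_def mult.assoc mult_left_mono simp flip: scaleR_diff_right simp del: scaleR_scaleR)
  \<comment> \<open>Only now does the bound on the centered mean become a bound on \<open>U\<close>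
    itself.\<close>
  have "u = 0" by (rule score_mean_zero[OF score' mean])
  then have rate: "bigo_P M (\<lambda>n \<omega>. \<theta>hat n \<omega> - \<theta>\<^sub>0) (\<lambda>n \<omega>. real n powr (-1/2))"
    using root_n_rate[OF score'] mean by simp

  let ?b = "real m / (2 * real m + 1)"
  have "?b \<le> 1/2" by (simp add: field_simps)
  \<comment> \<open>The exponent m/(2m+1) is below 1/2, so the lower bound on \<open>lam\<close>
    dominates n^(-1/2).\<close>
  have lam_large: "tight_P M (\<lambda>C n \<omega>. real n powr (-1/2) \<le> C * lam n \<omega>)"
  proof -
    have "tight_P M (\<lambda>C n \<omega>. norm (inverse (lam n \<omega>)) \<le> C * real n powr ?b)"
      using lam_inv by (subst (asm) bigo_P_iff) auto
    then show ?thesis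
    proof (rule tight_P_mono[where C\<^sub>1 = 0])
      fix C :: real assume "0 \<le> C"
      show "\<forall>\<^sub>F n in sequentially. \<forall>\<omega>\<in>space M. norm (inverse (lam n \<omega>)) \<le> C * real n powr ?b \<longrightarrow>
          real n powr (-1/2) \<le> C * lam n \<omega>"
        using eventually_ge_at_top[of 1]
      proof (eventually_elim, intro ballI impI)
        fix n :: nat and \<omega> assume n: "1 \<le> n" and \<omega>: "\<omega> \<in> space M"
          and inv: "norm (inverse (lam n \<omega>)) \<le> C * real n powr ?b"
        have lam: "lam n \<omega> > 0" by (rule lam_pos[OF n \<omega>])
        have "1 = lam n \<omega> * inverse (lam n \<omega>)" using lam by simp
        also have "\<dots> \<le> lam n \<omega> * (C * real n powr ?b)" using inv lam by (intro mult_left_mono) auto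
        also have "\<dots> \<le> lam n \<omega> * (C * real n powr (1/2))"
          using lam n \<open>0 \<le> C\<close> \<open>?b \<le> 1/2\<close> by (intro mult_left_mono powr_mono) auto
        finally have "real n powr (-1/2) * 1 \<le> real n powr (-1/2) * (lam n \<omega> * (C * real n powr (1/2)))"
          by (rule mult_left_mono) simp
        also have "\<dots> = C * lam n \<omega> * (real n powr (-1/2) * real n powr (1/2))" by (simp only: mult_ac)
        also have "real n powr (-1/2) * real n powr (1/2) = 1" using n by (simp flip: powr_add)
        finally show "real n powr (-1/2) \<le> C * lam n \<omega>" by simp
      qed
    qed
  qed

  have "bigo_P M (\<lambda>n \<omega>. (c *\<^sub>R I0) *v (\<theta>hat n \<omega> - \<theta>\<^sub>0) - U n \<omega>) (\<lambda>n \<omega>. (lam n \<omega>)\<^sup>2)"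
    by (rule estimator_expansion[OF score' rate lam_large])
  then have expansion: "tight_P M (\<lambda>C n \<omega>. norm ((c *\<^sub>R I0) *v (\<theta>hat n \<omega> - \<theta>\<^sub>0) - U n \<omega>) \<le> C * (lam n \<omega>)\<^sup>2)"
    by (subst (asm) bigo_P_iff) auto
  \<comment> \<open>Cost of undoing the matrix c times \<open>I0\<close>: one factor for the inverse
    of \<open>I0\<close>, one for the inverse of c.\<close>
  define K where "K = norm (matrix_inv I0) * \<bar>inverse c\<bar>"
  have normal: "norm (sqrt (real n) *\<^sub>R (\<theta>hat n \<omega> - \<theta>\<^sub>0)
      - (1 / sqrt (real n)) *\<^sub>R (\<Sum>i<n. matrix_inv I0 *v l0 (X i \<omega>))) \<le>
      sqrt (real n) * (K * norm ((c *\<^sub>R I0) *v (\<theta>hat n \<omega> - \<theta>\<^sub>0) - U n \<omega>))" if n: "1 \<le> n" for n \<omega>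
  proof -
    let ?\<Delta> = "\<theta>hat n \<omega> - \<theta>\<^sub>0" and ?L = "\<Sum>i<n. l0 (X i \<omega>)"
    have "1 / sqrt (real n) = sqrt (real n) * (1 / real n)"
      using n by (simp add: field_simps)
    then have "sqrt (real n) *\<^sub>R ?\<Delta> - (1 / sqrt (real n)) *\<^sub>R (\<Sum>i<n. matrix_inv I0 *v l0 (X i \<omega>)) =
        sqrt (real n) *\<^sub>R (?\<Delta> - (1 / real n) *\<^sub>R (matrix_inv I0 *v ?L))"
      by (simp add: scaleR_diff_right linear_sum[OF matrix_vector_mul_linear])
    also have "?\<Delta> - (1 / real n) *\<^sub>R (matrix_inv I0 *v ?L) =
        matrix_inv I0 *v (I0 *v ?\<Delta> - (1 / real n) *\<^sub>R ?L)"
      by (simp only: matrix_vector_mult_diff_distrib matrix_inv_vector_mult[OF assms(20)] matrix_vector_mult_scaleR)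
    also have "I0 *v ?\<Delta> - (1 / real n) *\<^sub>R ?L = inverse c *\<^sub>R ((c *\<^sub>R I0) *v ?\<Delta> - U n \<omega>)"
      using \<open>c \<noteq> 0\<close> by (simp add: U_def scaleR_diff_right flip: scaleR_matrix_vector_assoc)
    finally have "norm (sqrt (real n) *\<^sub>R ?\<Delta> - (1 / sqrt (real n)) *\<^sub>R (\<Sum>i<n. matrix_inv I0 *v l0 (X i \<omega>))) =
        sqrt (real n) * norm (matrix_inv I0 *v (inverse c *\<^sub>R ((c *\<^sub>R I0) *v ?\<Delta> - U n \<omega>)))" by simp
    also have "\<dots> \<le> sqrt (real n) * (norm (matrix_inv I0) * norm (inverse c *\<^sub>R ((c *\<^sub>R I0) *v ?\<Delta> - U n \<omega>)))"
      by (intro mult_left_mono norm_matrix_vector_mult_le) simp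
    finally show ?thesis by (simp add: K_def mult.assoc)
  qed
  have main: "bigo_P M (\<lambda>n \<omega>. sqrt (real n) *\<^sub>R (\<theta>hat n \<omega> - \<theta>\<^sub>0)
      - (1 / sqrt (real n)) *\<^sub>R (\<Sum>i<n. matrix_inv I0 *v l0 (X i \<omega>)))
      (\<lambda>n \<omega>. sqrt (real n) * (lam n \<omega>)\<^sup>2)"
  proof (rule bigo_PI[OF expansion, where C\<^sub>1 = 0])
    fix C :: real
    have "K \<ge> 0" by (simp add: K_def)
    have "\<forall>\<^sub>F n in sequentially. \<forall>\<omega>\<in>space M.
        norm ((c *\<^sub>R I0) *v (\<theta>hat n \<omega> - \<theta>\<^sub>0) - U n \<omega>) \<le> C * (lam n \<omega>)\<^sup>2 \<longrightarrow> True \<longrightarrow>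
        norm (sqrt (real n) *\<^sub>R (\<theta>hat n \<omega> - \<theta>\<^sub>0)
          - (1 / sqrt (real n)) *\<^sub>R (\<Sum>i<n. matrix_inv I0 *v l0 (X i \<omega>))) \<le>
        (K * C) * (sqrt (real n) * (lam n \<omega>)\<^sup>2)"
      using eventually_ge_at_top[of 1]
    proof (eventually_elim, intro ballI impI)
      fix n :: nat and \<omega> assume n: "1 \<le> n"
        and le: "norm ((c *\<^sub>R I0) *v (\<theta>hat n \<omega> - \<theta>\<^sub>0) - U n \<omega>) \<le> C * (lam n \<omega>)\<^sup>2"
      have "sqrt (real n) * (K * norm ((c *\<^sub>R I0) *v (\<theta>hat n \<omega> - \<theta>\<^sub>0) - U n \<omega>)) \<le>
          sqrt (real n) * (K * (C * (lam n \<omega>)\<^sup>2))"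
        using le \<open>K \<ge> 0\<close> by (intro mult_left_mono) auto
      then show "norm (sqrt (real n) *\<^sub>R (\<theta>hat n \<omega> - \<theta>\<^sub>0)
          - (1 / sqrt (real n)) *\<^sub>R (\<Sum>i<n. matrix_inv I0 *v l0 (X i \<omega>))) \<le>
        (K * C) * (sqrt (real n) * (lam n \<omega>)\<^sup>2)"
        using normal[OF n, of \<omega>] by (simp add: mult_ac)
    qed
    moreover have "whp M (\<lambda>n \<omega>. True)" by (simp add: whp_iff)
    ultimately show "\<exists>Q D. whp M Q \<and> (\<forall>\<^sub>F n in sequentially. \<forall>\<omega>\<in>space M.
        norm ((c *\<^sub>R I0) *v (\<theta>hat n \<omega> - \<theta>\<^sub>0) - U n \<omega>) \<le> C * (lam n \<omega>)\<^sup>2 \<longrightarrow> Q n \<omega> \<longrightarrow>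
        norm (sqrt (real n) *\<^sub>R (\<theta>hat n \<omega> - \<theta>\<^sub>0)
          - (1 / sqrt (real n)) *\<^sub>R (\<Sum>i<n. matrix_inv I0 *v l0 (X i \<omega>))) \<le>
        D * (sqrt (real n) * (lam n \<omega>)\<^sup>2))" by blast
  qed

  \<comment> \<open>Rates of the two iterations\<close>
  have G_eq: "(\<lambda>\<theta>. (1 / real n) *\<^sub>R grad (Sr n \<omega>) \<theta>) = G n \<omega>" for n \<omega>
    by (simp add: G_def fun_eq_iff)
  have iterates_I: "errors_of_increasing_order M
        (\<lambda>n \<omega> k. iterate_I n (Sr n \<omega>) (\<theta>init n \<omega>) k - \<theta>hat n \<omega>) \<psi> (\<lambda>k. 2 ^ k * \<psi>)"
    if \<psi>: "\<psi> > 0" "\<psi> \<le> 1/2" and init: "bigo_P M (\<lambda>n \<omega>. \<theta>init n \<omega> - \<theta>\<^sub>0) (\<lambda>n \<omega>. real n powr (- \<psi>))" for \<psi> \<theta>init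
  proof -
    \<comment> \<open>The observed information is exactly the negative Hessian, so
      \<open>newton_iterate_rate\<close> applies with the zero sequence and only the doubling
      constraint remains.\<close>
    have "tight_P M (\<lambda>C n \<omega>. \<forall>x\<in>ball \<theta>\<^sub>0 (\<delta>/2). norm (observed_info n (Sr n \<omega>) x + H n \<omega> x) \<le> C * 0)"
      by (simp add: observed_info_def H_def tight_P_def)
    then have "bigo_P M (\<lambda>n \<omega>. newton_iterate (observed_info n (Sr n \<omega>)) (G n \<omega>) (\<theta>init n \<omega>) k - \<theta>hat n \<omega>)
        (\<lambda>n \<omega>. real n powr (- (2 ^ k * \<psi>)))" for k
      by (rule newton_iterate_rate[where a = "\<lambda>_. 0" and r = "\<lambda>k. 2 ^ k * \<psi>"]) (use \<psi> init rate in auto)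
    then show ?thesis
      using \<psi> strict_mono_power_rate filterlim_power_rate
      by (simp add: errors_of_increasing_order_def iterate_I_def G_eq)
  qed
  have iterates_II: "errors_of_increasing_order M
        (\<lambda>n \<omega> k. iterate_II t1 t2 n (Sr n \<omega>) (\<theta>init n \<omega>) k - \<theta>hat n \<omega>) \<psi> (R \<psi> g)"
    if g: "g > 0" "g \<le> 1/2" and \<psi>: "1/2 - g < \<psi>" "\<psi> \<le> 1/2" and "t1 < t2"
      and init: "bigo_P M (\<lambda>n \<omega>. \<theta>init n \<omega> - \<theta>\<^sub>0) (\<lambda>n \<omega>. real n powr (- \<psi>))" for g \<psi> \<theta>init t1 t2
  proof -
    have "tight_P M (\<lambda>C n \<omega>. \<forall>x\<in>ball \<theta>\<^sub>0 (\<delta>/2).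
        norm (discretized_info t1 t2 n (Sr n \<omega>) x + H n \<omega> x) \<le> C * real n powr (-1/2))"
    proof (rule tight_P_mono[OF discretized_hessian[OF \<open>t1 < t2\<close>], where C\<^sub>1 = 0])
      fix C :: real
      show "\<forall>\<^sub>F n in sequentially. \<forall>\<omega>\<in>space M. (\<forall>x\<in>ball \<theta>\<^sub>0 (\<delta>/2). norm ((\<chi> i j.
          - ((G n \<omega> (x + (real n powr (-1/2) * t2) *\<^sub>R axis j 1) $ i
            - G n \<omega> (x + (real n powr (-1/2) * t1) *\<^sub>R axis j 1) $ i) / (real n powr (-1/2) * (t2 - t1))))
          + H n \<omega> x) \<le> C * real n powr (-1/2)) \<longrightarrow>
          (\<forall>x\<in>ball \<theta>\<^sub>0 (\<delta>/2). norm (discretized_info t1 t2 n (Sr n \<omega>) x + H n \<omega> x) \<le> C * real n powr (-1/2))"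
        using eventually_ge_at_top[of 1]
      proof eventually_elim
        case (elim n)
        \<comment> \<open>The definition multiplies the raw gradient difference by h, while
          \<open>G\<close> already contains 1/n = h * h; the same matrix is therefore a difference
          quotient of \<open>G\<close> with step h (t2 - t1).\<close>
        define h where "h = real n powr (-1/2)"
        have h: "h > 0" "1 / real n = h * h"
          using elim powr_half_neg_power2[of "real n"] by (auto simp: h_def power2_eq_square)
        have "discretized_info t1 t2 n (Sr n \<omega>) x = (\<chi> i j.
          - ((G n \<omega> (x + (h * t2) *\<^sub>R axis j 1) $ i
            - G n \<omega> (x + (h * t1) *\<^sub>R axis j 1) $ i) / (h * (t2 - t1))))" for \<omega> x
          unfolding discretized_info_def G_def h(2) vec_eq_iff h_def[symmetric]
          using h(1) by (simp flip: right_diff_distrib)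
        then show ?case by (simp only: h_def[symmetric]) simp
      qed
    qed
    then have "bigo_P M (\<lambda>n \<omega>. newton_iterate (discretized_info t1 t2 n (Sr n \<omega>)) (G n \<omega>) (\<theta>init n \<omega>) k - \<theta>hat n \<omega>)
        (\<lambda>n \<omega>. real n powr (- R \<psi> g k))" for k
    proof (rule newton_iterate_rate)
      show "(\<lambda>n. real n powr (-1/2)) \<longlonglongrightarrow> 0"
        by (intro tendsto_neg_powr filterlim_real_sequentially) simp
      show "bigo_P M (\<lambda>n \<omega>. \<theta>init n \<omega> - \<theta>\<^sub>0) (\<lambda>n \<omega>. real n powr (- R \<psi> g 0))" "R \<psi> g 0 \<le> 1/2"
        using init \<psi> by (simp_all add: R_0[OF g \<psi>])
      fix n k :: nat assume "1 \<le> n"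
      have "real n powr (-1/2) * real n powr (- R \<psi> g k) = real n powr (- (R \<psi> g k + 1/2))"
        by (subst powr_add[symmetric], rule arg_cong[where f = "(powr) (real n)"]) simp
      also have "\<dots> \<le> real n powr (- R \<psi> g (Suc k))"
        using \<open>1 \<le> n\<close> R_Suc_le(2)[OF g \<psi>, of k] by (intro powr_mono) auto
      finally show "real n powr (-1/2) * real n powr (- R \<psi> g k) \<le> real n powr (- R \<psi> g (Suc k))" .
    qed (use rate R_pos[OF g \<psi>] R_Suc_le(1)[OF g \<psi>] in auto)
    then show ?thesis
      using R_0[OF g \<psi>] strict_mono_R[OF g \<psi>] filterlim_R[OF g \<psi>]
      by (simp add: errors_of_increasing_order_def iterate_II_def G_eq)
  qed
  have final: "smallo_P M (\<lambda>n \<omega>. Y n \<omega> k) (\<lambda>n \<omega>. real n powr (-1/2))"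
    if "errors_of_increasing_order M Y \<psi> r" "r k > 1/2" for Y :: "nat \<Rightarrow> 'w \<Rightarrow> nat \<Rightarrow> real ^ 'd" and \<psi> r k
    using bigo_P_imp_smallo_P[of M "\<lambda>n \<omega>. Y n \<omega> k" "r k" "1/2"] that
    by (simp add: errors_of_increasing_order_def)

  show ?thesis
  proof (intro conjI allI impI)
    fix g assume "maximal_rate M lam g"
    show g4: "1/4 \<le> g"
      using maximal_rate_ge[OF \<open>maximal_rate M lam g\<close>, of "1/4"] lam_small by simp
    show gb: "g \<le> ?b" by (rule maximal_rate_le[OF \<open>maximal_rate M lam g\<close> lam_inv lam_pos])
    have g: "g > 0" "g \<le> 1/2" using g4 order_trans[OF gb \<open>?b \<le> 1/2\<close>] by auto
    fix \<psi> and \<theta>init :: "nat \<Rightarrow> 'w \<Rightarrow> real ^ 'd"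
    assume *: "1/2 - g < \<psi> \<and> \<psi> \<le> 1/2 \<and> bigo_P M (\<lambda>n \<omega>. \<theta>init n \<omega> - \<theta>\<^sub>0) (\<lambda>n \<omega>. real n powr (- \<psi>))"
    \<comment> \<open>Positivity of \<psi> follows because 1/2 - g is nonnegative.\<close>
    then have \<psi>: "1/2 - g < \<psi>" "\<psi> \<le> 1/2" "\<psi> > 0"
      and init: "bigo_P M (\<lambda>n \<omega>. \<theta>init n \<omega> - \<theta>\<^sub>0) (\<lambda>n \<omega>. real n powr (- \<psi>))"
      using g by auto
    note I = iterates_I[OF \<psi>(3,2) init]
    show "errors_of_increasing_order M
        (\<lambda>n \<omega> k. iterate_I n (Sr n \<omega>) (\<theta>init n \<omega>) k - \<theta>hat n \<omega>) \<psi> (\<lambda>k. 2 ^ k * \<psi>)" by (rule I)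
    show "smallo_P M
        (\<lambda>n \<omega>. iterate_I n (Sr n \<omega>) (\<theta>init n \<omega>) (int_gt (ln (1 / (2 * \<psi>)) / ln 2)) - \<theta>hat n \<omega>)
        (\<lambda>n \<omega>. real n powr (-1/2))"
      by (rule final[OF I power_rate_int_gt[OF \<psi>(3)]])
    fix t1 t2 :: real assume "t1 < t2"
    note II = iterates_II[OF g \<psi>(1,2) \<open>t1 < t2\<close> init]
    show "errors_of_increasing_order M
        (\<lambda>n \<omega> k. iterate_II t1 t2 n (Sr n \<omega>) (\<theta>init n \<omega>) k - \<theta>hat n \<omega>) \<psi> (R \<psi> g)" by (rule II)
    show "smallo_P M
        (\<lambda>n \<omega>. iterate_II t1 t2 n (Sr n \<omega>) (\<theta>init n \<omega>)
          (int_gt (ln (g / (g + \<psi> - 1/2)) / ln 2)) - \<theta>hat n \<omega>)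
        (\<lambda>n \<omega>. real n powr (-1/2))"
      by (rule final[OF II R_int_gt[OF g \<psi>(1,2)]])
  qed (rule main)
qed

end
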